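(* Let $K$ be a field of arbitrary characteristic, and let $$A_1=\frac{K[X,Y,Z]}{(f(X)Y-\varphi_1(X,Z))},\qquad A_2=\frac{K[X,Y,Z]}{(g(X)Y-\varphi_2(X,Z))},$$ where $f,g\in K[X]$ have degree at least $2$, and $\varphi_1,\varphi_2\in K[X,Z]$ are monic in $Z$ with $d_1:=\deg_Z(\varphi_1)\ge 2$ and $d_2:=\deg_Z(\varphi_2)\ge 2$. For $i=1,2$ let $x_i,y_i,z_i$ denote the images of $X,Y,Z$ in $A_i$. Let $f(x_1)=p_1^{\alpha_1}\cdots p_n^{\alpha_n}$ and $g(x_2)=q_1^{\beta_1}\cdots q_m^{\beta_m}$ be the prime factorizations of $f$ and $g$ in $K[x_1]$ and $K[x_2]$ respectively, where $\alpha_i,\beta_j\ge 1$ for all $i,j$. Let $T:A_1\to A_2$ be a $K$-algebra isomorphism. Then the following hold: (i) $T(x_1)=\lambda x_2+\mu$ and $T(z_1)=\gamma z_2+\delta$ for some $\lambda,\gamma\in K^*$, $\mu\in K$ and $\delta\in K[x_2]$. Moreover $n=m$. (ii) For each $i$, $1\le i\le n$, there are $j$ with $1\le j\le n$ and $\mu_{ij}\in K^*$ such that $T(p_i)=\mu_{ij}q_j$ and $\alpha_i=\beta_j$. (iii) $T(f(x_1))=u\,g(x_2)$ for some unit $u$ in $K$. (iv) $d_1=d_2$. (v) $T\big((f(x_1),\varphi_1(x_1,z_1))K[x_1,z_1]\big)=(g(x_2),\varphi_2(x_2,z_2))K[x_2,z_2]$. (vi) With $\lambda,\mu,\gamma,\delta$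 as in (i), $T(\varphi_1(x_1,z_1))=\varphi_1(\lambda x_2+\mu,\gamma z_2+\delta)=\gamma^{d_2}\varphi_2(x_2,z_2)+g(x_2)\theta(x_2,z_2)$ for some $\theta\in K[x_2,z_2]$ with $\deg_{z_2}(\theta)\le d_2-1$. (vii) With $u$ as in (iii), $\gamma$ as in (i) and $\theta$ as in (vi), $T(y_1)=u^{-1}\gamma^{d_2}y_2+\nu$, where $\nu=u^{-1}\theta$.
   Context: In the prime factorizations, $p_1,\dots,p_n$ are pairwise non-associate prime elements of $K[x_1]$ and $q_1,\dots,q_m$ are pairwise non-associate prime elements of $K[x_2]$; $n$ and $m$ are thus the numbers of distinct prime factors. $K^*=K\setminus\{0\}$. For elements $a,b$ of a ring $R$, $(a,b)R$ denotes the ideal of $R$ generated by $a$ and $b$. The elements $x_i,z_i$ of $A_i$ are algebraically independent over $K$, so $K[x_i]$ and $K[x_i,z_i]$ are polynomial rings. *)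

theory Defs
  imports
    "HOL-Computational_Algebra.Computational_Algebra"
    "HOL-Algebra.QuotRing"
    "HOL-Algebra.Algebraic_Closure_Type"
begin

text \<open>
  Polynomial rings are iterated: \<open>'k poly\<close> is \<open>K[X]\<close>, \<open>'k poly poly\<close> is \<open>K[X,Z] = K[X][Z]\<close>
  and \<open>'k poly poly poly\<close> is \<open>K[X,Y,Z] = K[X][Z][Y]\<close>. Hence for \<open>\<phi> :: 'k poly poly\<close>, \<open>degree \<phi>\<close> is
  the degree in \<open>Z\<close>, and \<open>\<phi>\<close> is monic in \<open>Z\<close> iff \<open>lead_coeff \<phi> = 1\<close>.
\<close>

text \<open>The ideal generated by \<open>f(X) Y - \<phi>(X,Z)\<close>.\<close>

definition surf_ideal :: "'k::field poly \<Rightarrow> 'k poly poly \<Rightarrow> 'k poly poly poly set" where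
  "surf_ideal f \<phi> = genideal ring_of_type_algebra {[: - \<phi>, [:f:] :]}"

definition surf :: "'k::field poly \<Rightarrow> 'k poly poly \<Rightarrow> 'k poly poly poly set ring" where
  "surf f \<phi> = ring_of_type_algebra Quot (surf_ideal f \<phi>)"

definition cls :: "'k::field poly \<Rightarrow> 'k poly poly \<Rightarrow> 'k poly poly poly \<Rightarrow> 'k poly poly poly set" where
  "cls f \<phi> P = surf_ideal f \<phi> +>\<^bsub>ring_of_type_algebra\<^esub> P"

text \<open>
  \<open>at_xz f \<phi> r\<close> is \<open>r(x,z)\<close>, \<open>at_x f \<phi> r\<close> is \<open>r(x)\<close> and \<open>scal f \<phi> c\<close> is the scalar \<open>c\<close>, all as
  elements of \<open>surf f \<phi>\<close>.
\<close>

definition at_xz :: "'k::field poly \<Rightarrow> 'k poly poly \<Rightarrow> 'k poly poly \<Rightarrow> 'k poly poly poly set" where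
  "at_xz f \<phi> r = cls f \<phi> [:r:]"

definition at_x :: "'k::field poly \<Rightarrow> 'k poly poly \<Rightarrow> 'k poly \<Rightarrow> 'k poly poly poly set" where
  "at_x f \<phi> r = cls f \<phi> [:[:r:]:]"

definition scal :: "'k::field poly \<Rightarrow> 'k poly poly \<Rightarrow> 'k \<Rightarrow> 'k poly poly poly set" where
  "scal f \<phi> c = cls f \<phi> [:[:[:c:]:]:]"

definition gen_x :: "'k::field poly \<Rightarrow> 'k poly poly \<Rightarrow> 'k poly poly poly set" where
  "gen_x f \<phi> = cls f \<phi> [:[:[:0, 1:]:]:]"

definition gen_z :: "'k::field poly \<Rightarrow> 'k poly poly \<Rightarrow> 'k poly poly poly set" where
  "gen_z f \<phi> = cls f \<phi> [:[:0, 1:]:]"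

definition gen_y :: "'k::field poly \<Rightarrow> 'k poly poly \<Rightarrow> 'k poly poly poly set" where
  "gen_y f \<phi> = cls f \<phi> [:0, 1:]"

text \<open>The subring \<open>K[x,z]\<close> of \<open>surf f \<phi>\<close>.\<close>

definition sub_xz :: "'k::field poly \<Rightarrow> 'k poly poly \<Rightarrow> 'k poly poly poly set ring" where
  "sub_xz f \<phi> = (surf f \<phi>)\<lparr>carrier := range (at_xz f \<phi>)\<rparr>"

definition surf_iso ::
  "'k::field poly \<Rightarrow> 'k poly poly \<Rightarrow> 'k poly \<Rightarrow> 'k poly poly \<Rightarrow>
    ('k poly poly poly set \<Rightarrow> 'k poly poly poly set) set" where
  "surf_iso f \<phi> g \<psi> =
    {T \<in> ring_iso (surf f \<phi>) (surf g \<psi>). \<forall>c. T (scal f \<phi> c) = scal g \<psi> c}"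

text \<open>\<open>subst_xz \<phi> a b\<close> is \<open>\<phi>(a, b)\<close>: substitute \<open>a\<close> for \<open>X\<close> and \<open>b\<close> for \<open>Z\<close>.\<close>

definition subst_xz :: "'k::field poly poly \<Rightarrow> 'k poly poly \<Rightarrow> 'k poly poly \<Rightarrow> 'k poly poly" where
  "subst_xz \<phi> a b = poly (map_poly (\<lambda>c. poly (map_poly (\<lambda>k. [:[:k:]:]) c) a) \<phi>) b"

end

theory Submission
  imports Defs
begin

text \<open>
  Since \<open>\<phi>2\<close> is monic in \<open>Z\<close>, the ring \<open>A\<^sub>2\<close> embeds into \<open>K(x)[z]\<close> by \<open>Y \<mapsto> \<phi>2/g\<close>, and composing with \<open>T\<close>
  turns the isomorphism into a ring homomorphism \<open>\<tau>\<close> from \<open>K[X,Y,Z]\<close> to \<open>K(x)[z]\<close>. Write \<open>\<xi>\<close> and \<open>\<zeta>\<close>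
  for the images of \<open>x\<^sub>1\<close> and \<open>z\<^sub>1\<close>, and put \<open>n = deg g\<close>, \<open>d = deg \<phi>2\<close>.

  The heart of the matter is that \<open>\<xi>\<close> lies in \<open>K[x]\<close> (\<open>degree_xi_eq_0\<close>). Give \<open>b \<noteq> 0\<close> in \<open>K(x)[z]\<close> the value
  (\<open>z\<close>-degree of \<open>b\<close>, \<open>x\<close>-degree of its leading coefficient) in \<open>\<int>\<^sup>2\<close>. Values add under multiplication, and a
  sum of two elements of different values has one of these two values. Every element of \<open>A\<^sub>2\<close> is a
  polynomial in \<open>y\<close> with coefficients in \<open>K[x,z]\<close> of \<open>z\<close>-degree below \<open>d\<close> (\<open>has_reduced_form_all\<close>), so
  all values \<open>(s,l)\<close> on \<open>A\<^sub>2\<close> satisfy \<open>l \<ge> -n \<lfloor>s/d\<rfloor>\<close>; among them are \<open>X = (0,1)\<close>, \<open>Z = (1,0)\<close> and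
  \<open>Y = (d,-n)\<close>, the values of \<open>x\<close>, \<open>z\<close> and \<open>y\<close>.

  Suppose that \<open>\<xi>\<close> has a value \<open>v\<close> with positive first component. Up to powers of \<open>f(\<xi>)\<close>, every element
  of \<open>A\<^sub>2\<close> is a polynomial in \<open>\<zeta>\<close> over \<open>K[\<xi>]\<close>, and every nonzero element of \<open>K[\<xi>]\<close> has a value in \<open>\<nat>v\<close>.
  Among the polynomials in \<open>\<xi>, \<zeta>\<close> whose value is not parallel to \<open>v\<close>, choose \<open>b\<close> of least degree
  in \<open>\<zeta>\<close>. Repeated pseudo-division by \<open>b\<close> shows that every value on \<open>A\<^sub>2\<close> is \<open>i \<beta> + \<rho> + m v\<close>, where \<open>\<beta>\<close> is the
  value of \<open>b\<close>, \<open>i \<ge> 0\<close> and \<open>\<rho>\<close> is a value parallel to \<open>v\<close> (\<open>value_decomposition\<close>): modulo the direction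
  of \<open>v\<close>, the values are multiples of a single one. If \<open>v\<close> does not point in the direction of \<open>Y\<close>, then \<open>X\<close> and
  \<open>Y\<close> lie strictly on opposite sides of the line through \<open>v\<close>, so the multiples \<open>i\<close> would take both signs. If \<open>v\<close>
  points in the direction of \<open>Y\<close>, then everything parallel to \<open>v\<close> is a multiple of \<open>Y\<close>, so modulo \<open>Y\<close> both \<open>X\<close> and
  \<open>Z\<close> are multiples of \<open>\<beta>\<close>, which is itself a value on \<open>A\<^sub>2\<close>. As \<open>n X = d Z\<close> generates the relations between \<open>X\<close> and \<open>Z\<close>
  modulo \<open>Y\<close>, this needs \<open>n = 1\<close> or \<open>d = 1\<close>.
  No derivation occurs in this argument, which is why the characteristic does not matter.

  The rest follows by comparing leading coefficients. Applying the above to \<open>T\<close> and to its inverse,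
  \<open>\<xi>\<close> must be linear in \<open>x\<close>; since \<open>K(x)[z] = K(x)[\<zeta>]\<close>, the element \<open>\<zeta>\<close> has degree 1 in \<open>z\<close>, hence lies in \<open>K[x,z]\<close>, and its
  leading coefficient is a unit by symmetry (\<open>linear_forms\<close>). The image of \<open>y\<^sub>1\<close> has \<open>z\<close>-degree \<open>d\<^sub>1\<close> and leading
  coefficient a constant over \<open>f(\<lambda>x + \<mu>)\<close>. In \<open>A\<^sub>2\<close> denominators first occur in degree \<open>d\<^sub>2\<close>, and there
  they divide \<open>g\<close>. By symmetry \<open>d\<^sub>1 = d\<^sub>2\<close> and \<open>f(\<lambda>x + \<mu>)\<close> is associated with \<open>g\<close>. Subtracting the right
  multiple of \<open>y\<^sub>2\<close> from the image of \<open>y\<^sub>1\<close> leaves an element of smaller degree, which is \<open>u\<inverse>\<theta>\<close>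
  (\<open>isomorphism_normal_form\<close>). The statement about prime factors is unique factorization in \<open>K[x]\<close>.
\<close>

section \<open>The coordinate ring inside \<open>K(x)[z]\<close>\<close>

text \<open>
  The image of \<open>Y\<close> under the embedding, that is \<open>\<phi>/g\<close>; \<open>fract_poly\<close> is the inclusion of \<open>K[x,z]\<close> into \<open>K(x)[z]\<close>.
\<close>

definition y_elem :: "'k::field poly \<Rightarrow> 'k poly poly \<Rightarrow> 'k poly fract poly" where
  "y_elem g \<phi> = smult (inverse (to_fract g)) (fract_poly \<phi>)"

definition ev :: "'k::field poly \<Rightarrow> 'k poly poly \<Rightarrow> 'k poly poly poly \<Rightarrow> 'k poly fract poly" where
  "ev g \<phi> P = poly (map_poly fract_poly P) (y_elem g \<phi>)"

text \<open>The defining relation \<open>g Y - \<phi>\<close>, which generates the kernel of \<^term>\<open>ev g \<phi>\<close>.\<close>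

definition rel :: "'k::field poly \<Rightarrow> 'k poly poly \<Rightarrow> 'k poly poly poly" where
  "rel g \<phi> = [:- \<phi>, [:g:]:]"

lemma fract_poly_const [simp]: "fract_poly [:c:] = [:to_fract c:]"
  by (cases "c = 0") (simp_all add: map_poly_pCons)

lemma degree_fract_poly [simp]: "degree (fract_poly c) = degree c"
  by (rule degree_map_poly) simp

lemma coeff_fract_poly [simp]: "coeff (fract_poly c) i = to_fract (coeff c i)"
  by (simp add: coeff_map_poly)

lemma ev_0 [simp]: "ev g \<phi> 0 = 0"
  by (simp add: ev_def)

lemma ev_pCons [simp]: "ev g \<phi> (pCons c P) = fract_poly c + y_elem g \<phi> * ev g \<phi> P"
  by (simp add: ev_def map_poly_pCons)

lemma ev_add [simp]: "ev g \<phi> (P + Q) = ev g \<phi> P + ev g \<phi> Q"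
  by (induction P Q rule: poly_induct2) (simp_all add: algebra_simps)

lemma ev_smult [simp]: "ev g \<phi> (smult c P) = fract_poly c * ev g \<phi> P"
  by (induction P) (simp_all add: algebra_simps)

lemma ev_mult [simp]: "ev g \<phi> (P * Q) = ev g \<phi> P * ev g \<phi> Q"
  by (induction P) (simp_all add: algebra_simps)

lemma ev_minus [simp]: "ev g \<phi> (- P) = - ev g \<phi> P"
  using ev_add[of g \<phi> P "- P"] by (simp add: eq_neg_iff_add_eq_0 add.commute)

lemma ev_diff [simp]: "ev g \<phi> (P - Q) = ev g \<phi> P - ev g \<phi> Q"
  using ev_add[of g \<phi> P "- Q"] by simp

lemma fract_poly_minus [simp]: "fract_poly (- c) = - fract_poly c"
  by (rule poly_eqI) simp

locale surface =
  fixes g :: "'k::field poly" and \<phi> :: "'k poly poly"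
  assumes g_nonzero: "g \<noteq> 0" and monic: "lead_coeff \<phi> = 1" and degree_pos: "degree \<phi> \<ge> 1"
begin

abbreviation "d \<equiv> degree \<phi>"

lemma ev_rel [simp]: "ev g \<phi> (rel g \<phi>) = 0"
  using g_nonzero by (simp add: rel_def y_elem_def)

definition reduced :: "'k poly poly poly \<Rightarrow> bool" where
  "reduced P \<longleftrightarrow> (\<forall>i. degree (coeff P i) < d)"

lemma reduced_pCons: "reduced (pCons c P) \<longleftrightarrow> degree c < d \<and> reduced P"
  unfolding reduced_def by (auto simp: coeff_pCons split: nat.splits)

lemma reduced_0 [simp]: "reduced 0"
  using degree_pos by (simp add: reduced_def)

definition has_reduced_form :: "'k poly poly poly \<Rightarrow> bool" where
  "has_reduced_form P \<longleftrightarrow> (\<exists>P'. reduced P' \<and> rel g \<phi> dvd P - P')"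

lemma has_reduced_form_add: "has_reduced_form P \<Longrightarrow> has_reduced_form Q \<Longrightarrow> has_reduced_form (P + Q)"
proof -
  assume "has_reduced_form P" "has_reduced_form Q"
  then obtain P' Q' where *: "reduced P'" "rel g \<phi> dvd P - P'" "reduced Q'" "rel g \<phi> dvd Q - Q'"
    unfolding has_reduced_form_def by blast
  have "reduced (P' + Q')" using * unfolding reduced_def by (auto intro: degree_add_less)
  moreover have "rel g \<phi> dvd (P + Q) - (P' + Q')"
    using dvd_add[OF *(2,4)] by (simp add: algebra_simps)
  ultimately show ?thesis unfolding has_reduced_form_def by blast
qed

lemma has_reduced_form_cong: "has_reduced_form P \<Longrightarrow> rel g \<phi> dvd Q - P \<Longrightarrow> has_reduced_form Q"
  unfolding has_reduced_form_def by (metis (no_types, lifting) diff_add_cancel add_diff_eq dvd_add)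

lemma has_reduced_form_Y: "has_reduced_form P \<Longrightarrow> has_reduced_form (pCons 0 P)"
proof -
  assume "has_reduced_form P"
  then obtain P' where *: "reduced P'" "rel g \<phi> dvd P - P'" unfolding has_reduced_form_def by blast
  have "pCons 0 P - pCons 0 P' = [:0, 1:] * (P - P')" by simp
  with * have "rel g \<phi> dvd pCons 0 P - pCons 0 P'" by (metis dvd_mult)
  moreover have "reduced (pCons 0 P')" using * degree_pos by (simp add: reduced_pCons)
  ultimately show ?thesis unfolding has_reduced_form_def by blast
qed

lemma reduced_imp_reducible: "reduced P \<Longrightarrow> has_reduced_form P"
  unfolding has_reduced_form_def by (metis diff_self dvd_0_right)

text \<open>
  Multiplication by \<open>Z\<close> can raise the \<open>Z\<close>-degree of a coefficient to \<open>d\<close>, but then only by a multiple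
  \<open>k \<phi>\<close> with \<open>k\<close> in \<open>K[X]\<close>, and \<open>k \<phi>\<close> is congruent to \<open>k g Y\<close>. This is the only place where the relation is used
  to obtain normal forms.
\<close>

lemma has_reduced_form_Z_reduced: "reduced P \<Longrightarrow> has_reduced_form (smult [:0, 1:] P)"
proof (induction P)
  case 0
  show ?case by (simp add: reduced_imp_reducible)
next
  case (pCons c P)
  have c: "degree c < d" and P: "reduced P" using pCons.prems by (simp_all add: reduced_pCons)
  define k where "k = coeff (pCons 0 c) d"
  define c' where "c' = pCons 0 c - smult k \<phi>"
  have "degree (pCons 0 c) \<le> d" using c by (simp add: degree_pCons_eq_if)
  then have "degree c' \<le> d" unfolding c'_def by (meson degree_diff_le degree_smult_le order_trans order_refl)
  moreover have "coeff c' d = 0" using monic by (simp add: c'_def k_def)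
  ultimately have "degree c' < d" using degree_pos
    by (metis One_nat_def Suc_le_lessD degree_0 le_neq_implies_less leading_coeff_0_iff)
  then have r1: "has_reduced_form [:c':]"
    by (intro reduced_imp_reducible) (simp add: reduced_pCons)
  have "reduced [:[:k * g:]:]" using degree_pos by (simp add: reduced_pCons)
  then have r2: "has_reduced_form (pCons 0 [:[:k * g:]:])"
    by (intro has_reduced_form_Y reduced_imp_reducible)
  have r3: "has_reduced_form (pCons 0 (smult [:0, 1:] P))" by (intro has_reduced_form_Y pCons.IH P)
  have "smult [:0, 1:] (pCons c P) - ([:c':] + pCons 0 [:[:k * g:]:] + pCons 0 (smult [:0,1:] P))
      = rel g \<phi> * [:[:- k:]:]"
    by (simp add: c'_def rel_def)
  then show ?case
    using has_reduced_form_cong[OF has_reduced_form_add[OF has_reduced_form_add[OF r1 r2] r3]] by (metis dvd_triv_left)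
qed

lemma has_reduced_form_Z: "has_reduced_form P \<Longrightarrow> has_reduced_form (smult [:0, 1:] P)"
proof -
  assume "has_reduced_form P"
  then obtain P' where *: "reduced P'" "rel g \<phi> dvd P - P'" unfolding has_reduced_form_def by blast
  have "rel g \<phi> dvd smult [:0,1:] (P - P')" using * dvd_smult by blast
  then show ?thesis
    using has_reduced_form_cong[OF has_reduced_form_Z_reduced[OF *(1)]] by (simp add: smult_diff_right)
qed

lemma has_reduced_form_const: "has_reduced_form [:c:]"
proof (induction c)
  case 0
  show ?case by (simp add: reduced_imp_reducible)
next
  case (pCons a c)
  have "has_reduced_form ([:[:a:]:] + smult [:0, 1:] [:c:])"
    using degree_pos
    by (intro has_reduced_form_add has_reduced_form_Z pCons.IH reduced_imp_reducible) (simp add: reduced_pCons)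
  then show ?case by simp
qed

lemma has_reduced_form_all: "has_reduced_form P"
proof (induction P)
  case 0
  show ?case by (simp add: reduced_imp_reducible)
next
  case (pCons c P)
  have "has_reduced_form ([:c:] + pCons 0 P)"
    by (intro has_reduced_form_add has_reduced_form_const has_reduced_form_Y pCons.IH)
  then show ?case by simp
qed

text \<open>
  In a reduced expression \<open>\<Sum> y\<^sup>j c\<^sub>j\<close> the summands have the distinct \<open>z\<close>-degrees \<open>d j + deg c\<^sub>j\<close>, so the top
  summand alone decides the degree and the leading coefficient, whose denominator is \<open>g\<^sup>j\<close> with
  \<open>j = deg div d\<close>.
\<close>

lemma reduced_ev:
  assumes "reduced P" "P \<noteq> 0"
  shows "ev g \<phi> P \<noteq> 0 \<and>
    (\<exists>r. r \<noteq> 0 \<and> lead_coeff (ev g \<phi> P) * to_fract g ^ (degree (ev g \<phi> P) div d) = to_fract r) \<and>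
    (degree (ev g \<phi> P) < d \<longrightarrow> (\<exists>c. ev g \<phi> P = fract_poly c))"
  using assms
proof (induction P)
  case (pCons c P)
  have c: "degree c < d" and P: "reduced P" using pCons.prems by (simp_all add: reduced_pCons)
  show ?case
  proof (cases "P = 0")
    case True
    then have "c \<noteq> 0" using pCons.hyps by simp
    then show ?thesis using True c by auto
  next
    case False
    define e where "e = ev g \<phi> P"
    obtain r where e: "e \<noteq> 0" "r \<noteq> 0" "lead_coeff e * to_fract g ^ (degree e div d) = to_fract r"
      using pCons.IH[OF P False] by (auto simp: e_def)
    have y: "y_elem g \<phi> \<noteq> 0" "degree (y_elem g \<phi>) = d" "lead_coeff (y_elem g \<phi>) = inverse (to_fract g)"
      using g_nonzero degree_pos monic by (auto simp: y_elem_def)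
    have deg: "degree (y_elem g \<phi> * e) = d + degree e"
      using y e by (simp add: degree_mult_eq)
    have lt: "degree (fract_poly c) < degree (y_elem g \<phi> * e)" using c deg by simp
    have deg': "degree (ev g \<phi> (pCons c P)) = d + degree e"
      using degree_add_eq_right[OF lt] deg by (simp add: e_def)
    have lc: "lead_coeff (ev g \<phi> (pCons c P)) = inverse (to_fract g) * lead_coeff e"
      using lead_coeff_add_le[OF lt] y(3) by (simp add: e_def lead_coeff_mult)
    have "(d + degree e) div d = Suc (degree e div d)"
      using degree_pos by simp
    then have "lead_coeff (ev g \<phi> (pCons c P)) * to_fract g ^ (degree (ev g \<phi> (pCons c P)) div d)
        = to_fract r"
      unfolding lc unfolding deg' using e(3) g_nonzero by (simp add: field_simps)
    moreover have "ev g \<phi> (pCons c P) \<noteq> 0" using deg' degree_pos by force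
    moreover have "\<not> degree (ev g \<phi> (pCons c P)) < d" using deg' by simp
    ultimately show ?thesis using e(2) by blast
  qed
qed simp

text \<open>
  A nonzero reduced polynomial has a nonzero image, so normal forms are unique and the kernel is no
  larger than the ideal of the relation.
\<close>

lemma ev_eq_0_iff: "ev g \<phi> P = 0 \<longleftrightarrow> rel g \<phi> dvd P"
proof
  assume 0: "ev g \<phi> P = 0"
  obtain P' where P': "reduced P'" "rel g \<phi> dvd P - P'"
    using has_reduced_form_all[of P] unfolding has_reduced_form_def by blast
  obtain Q where "P - P' = rel g \<phi> * Q" using P'(2) by (elim dvdE)
  then have "ev g \<phi> (P - P') = 0" by (simp del: ev_diff)
  then have "P' = 0" using reduced_ev[OF P'(1)] 0 by fastforce
  then show "rel g \<phi> dvd P" using P' by simp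
next
  assume "rel g \<phi> dvd P"
  then show "ev g \<phi> P = 0" by (auto elim!: dvdE)
qed

lemma ev_eq_iff: "ev g \<phi> P = ev g \<phi> Q \<longleftrightarrow> rel g \<phi> dvd P - Q"
  using ev_eq_0_iff[of "P - Q"] by simp

text \<open>
  The two facts about \<open>A\<^sub>2\<close> on which all later comparisons rest: the denominator of a leading coefficient
  is bounded by a power of \<open>g\<close> that depends on the degree, and there are no denominators at all below degree \<open>d\<close>.
\<close>

lemma coord_ring_elem:
  assumes "b \<in> range (ev g \<phi>)" "b \<noteq> 0"
  shows "\<exists>r. r \<noteq> 0 \<and> lead_coeff b * to_fract g ^ (degree b div d) = to_fract r"
    and "degree b < d \<Longrightarrow> \<exists>c. b = fract_poly c"
proof -
  obtain P where b: "b = ev g \<phi> P" using assms by blast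
  obtain P' where P': "reduced P'" "rel g \<phi> dvd P - P'"
    using has_reduced_form_all[of P] unfolding has_reduced_form_def by blast
  have b': "b = ev g \<phi> P'" using P'(2) ev_eq_iff b by simp
  with assms have "P' \<noteq> 0" by auto
  from reduced_ev[OF P'(1) this] show
    "\<exists>r. r \<noteq> 0 \<and> lead_coeff b * to_fract g ^ (degree b div d) = to_fract r"
    "degree b < d \<Longrightarrow> \<exists>c. b = fract_poly c" unfolding b' by auto
qed

lemma clear_denominator: "\<exists>N h. ev g \<phi> (smult [:g ^ N:] P) = fract_poly h"
proof (induction P)
  case 0
  show ?case by (intro exI[of _ 0]) simp
next
  case (pCons c P)
  then obtain N h where *: "ev g \<phi> (smult [:g ^ N:] P) = fract_poly h" by blast
  have "ev g \<phi> (smult [:g ^ Suc N:] (pCons c P))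
     = fract_poly ([:g ^ Suc N:] * c) + fract_poly [:g:] * y_elem g \<phi> * ev g \<phi> (smult [:g ^ N:] P)"
    by (simp add: algebra_simps)
  also have "fract_poly [:g:] * y_elem g \<phi> = fract_poly \<phi>"
    using g_nonzero by (simp add: y_elem_def)
  finally have "ev g \<phi> (smult [:g ^ Suc N:] (pCons c P)) = fract_poly ([:g ^ Suc N:] * c + \<phi> * h)"
    unfolding * by simp
  then show ?case by blast
qed

end


section \<open>A degree with values in \<open>\<int>\<^sup>2\<close>\<close>

text \<open>The degree of a rational function: numerator minus denominator.\<close>

definition fract_degree :: "'k::field poly fract \<Rightarrow> int" where
  "fract_degree q =
    (THE k. \<exists>a b. a \<noteq> 0 \<and> b \<noteq> 0 \<and> q = Fract a b \<and> k = int (degree a) - int (degree b))"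

lemma fract_degree_Fract:
  assumes "a \<noteq> 0" "b \<noteq> 0"
  shows "fract_degree (Fract a b) = int (degree a) - int (degree b)"
  unfolding fract_degree_def
proof (rule the_equality)
  fix k assume "\<exists>c e. c \<noteq> 0 \<and> e \<noteq> 0 \<and> Fract a b = Fract c e \<and> k = int (degree c) - int (degree e)"
  then obtain c e where ce: "c \<noteq> 0" "e \<noteq> 0" "Fract a b = Fract c e" "k = int (degree c) - int (degree e)"
    by blast
  then have "a * e = c * b" using assms by (simp add: eq_fract)
  then have "degree a + degree e = degree c + degree b" using assms ce by (metis degree_mult_eq)
  with ce show "k = int (degree a) - int (degree b)" by simp
qed (use assms in blast)

lemma nonzero_fractE:
  assumes "q \<noteq> 0"
  obtains a b where "a \<noteq> 0" "b \<noteq> 0" "q = Fract a b"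
  using assms by (cases q rule: Fract_cases_nonzero) auto

lemma fract_degree_to_fract [simp]: "a \<noteq> 0 \<Longrightarrow> fract_degree (to_fract a) = int (degree a)"
  by (simp add: to_fract_def fract_degree_Fract)

lemma fract_degree_mult:
  assumes "p \<noteq> 0" "q \<noteq> 0"
  shows "fract_degree (p * q) = fract_degree p + fract_degree q"
  using assms(1,2)
  by (elim nonzero_fractE) (simp add: fract_degree_Fract degree_mult_eq)

lemma fract_degree_inverse:
  assumes "q \<noteq> 0"
  shows "fract_degree (inverse q) = - fract_degree q"
  using assms by (elim nonzero_fractE) (simp add: fract_degree_Fract)

lemma fract_degree_add:
  assumes "p \<noteq> 0" "q \<noteq> 0" "fract_degree p \<noteq> fract_degree q"
  shows "p + q \<noteq> 0 \<and> fract_degree (p + q) \<in> {fract_degree p, fract_degree q}"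
proof -
  obtain a b where ab: "a \<noteq> 0" "b \<noteq> 0" "p = Fract a b" using nonzero_fractE[OF assms(1)] .
  obtain c e where ce: "c \<noteq> 0" "e \<noteq> 0" "q = Fract c e" using nonzero_fractE[OF assms(2)] .
  have pq: "p + q = Fract (a * e + c * b) (b * e)" using ab ce by simp
  have ne: "degree (a * e) \<noteq> degree (c * b)"
    using assms(3) ab ce by (simp add: fract_degree_Fract degree_mult_eq)
  then have "degree (a * e + c * b) = degree (a * e) \<or> degree (a * e + c * b) = degree (c * b)"
    by (metis degree_add_eq_left degree_add_eq_right linorder_neqE_nat)
  moreover have nz: "a * e + c * b \<noteq> 0"
    using ne by (metis add_eq_0_iff degree_minus)
  moreover have "p + q \<noteq> 0"
    unfolding pq using nz ab ce by (simp add: Zero_fract_def eq_fract)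
  ultimately show ?thesis
    unfolding pq using ab ce by (auto simp: fract_degree_Fract degree_mult_eq)
qed

definition zdeg :: "'k::field poly fract poly \<Rightarrow> int" where
  "zdeg b = int (degree b)"

definition xdeg :: "'k::field poly fract poly \<Rightarrow> int" where
  "xdeg b = fract_degree (lead_coeff b)"

lemma zdeg_mult: "a \<noteq> 0 \<Longrightarrow> b \<noteq> 0 \<Longrightarrow> zdeg (a * b) = zdeg a + zdeg b"
  by (simp add: zdeg_def degree_mult_eq)

lemma xdeg_mult: "a \<noteq> 0 \<Longrightarrow> b \<noteq> 0 \<Longrightarrow> xdeg (a * b) = xdeg a + xdeg b"
  by (simp add: xdeg_def lead_coeff_mult fract_degree_mult)

text \<open>
  The larger of two different values in the lexicographic order survives in a sum. Which one it is will
  not matter, so the order itself is not mentioned.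
\<close>

lemma deg_add:
  assumes nz: "a \<noteq> 0" "b \<noteq> 0" and ne: "(zdeg a, xdeg a) \<noteq> (zdeg b, xdeg b)"
  shows "(zdeg (a + b), xdeg (a + b)) \<in> {(zdeg a, xdeg a), (zdeg b, xdeg b)}"
proof -
  consider "degree a < degree b" | "degree b < degree a" | "degree a = degree b" by linarith
  then show ?thesis
  proof cases
    case 1
    then show ?thesis by (simp add: zdeg_def xdeg_def degree_add_eq_right coeff_eq_0)
  next
    case 2
    then show ?thesis
      by (simp add: zdeg_def xdeg_def degree_add_eq_left coeff_eq_0)
  next
    case 3
    have *: "lead_coeff a + lead_coeff b \<noteq> 0 \<and> fract_degree (lead_coeff a + lead_coeff b) \<in>
        {fract_degree (lead_coeff a), fract_degree (lead_coeff b)}"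
    proof (intro fract_degree_add)
      show "lead_coeff a \<noteq> 0" "lead_coeff b \<noteq> 0" using nz by simp_all
      show "fract_degree (lead_coeff a) \<noteq> fract_degree (lead_coeff b)"
        using ne 3 by (simp add: zdeg_def xdeg_def)
    qed
    then have c: "coeff (a + b) (degree a) \<noteq> 0" using 3 by simp
    then have "degree (a + b) = degree a"
      using 3 degree_add_le[of a "degree a" b] le_degree[OF c] by simp
    then show ?thesis using * 3 by (auto simp: zdeg_def xdeg_def)
  qed
qed

lemma (in surface) xdeg_lower_bound:
  assumes "b \<in> range (ev g \<phi>)" "b \<noteq> 0"
  shows "xdeg b \<ge> - int (degree g) * (zdeg b div int d)"
proof -
  obtain r where r: "r \<noteq> 0" "lead_coeff b * to_fract g ^ (degree b div d) = to_fract r"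
    using coord_ring_elem[OF assms] by blast
  have "fract_degree (to_fract g ^ k) = int k * int (degree g)" for k
    using g_nonzero
    by (induction k) (auto simp: fract_degree_mult algebra_simps One_fract_def fract_degree_Fract)
  then have "xdeg b + int (degree b div d) * int (degree g) = int (degree r)"
    using r g_nonzero assms(2) fract_degree_mult[of "lead_coeff b" "to_fract g ^ (degree b div d)"]
    by (simp add: xdeg_def)
  then show ?thesis by (simp add: zdeg_def zdiv_int algebra_simps)
qed

section \<open>Semigroups in \<open>\<int>\<^sup>2\<close> that are cyclic modulo a line\<close>

text \<open>
  On the line spanned by \<open>(d,-n)\<close> the integer points that satisfy the bound for the values on \<open>A\<^sub>2\<close> are
  multiples of \<open>(d,-n)\<close>, because of the rounding in that bound.
\<close>

lemma ray_multiple: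
  fixes n d c1 c2 :: int
  assumes "n \<ge> 1" "d \<ge> 1" and ray: "d * c2 = - n * c1" and bound: "c2 \<ge> - n * (c1 div d)"
  shows "\<exists>k. c1 = d * k \<and> c2 = - n * k"
proof -
  have "d * c2 \<ge> - n * (d * (c1 div d))" using bound assms(2)
    by (metis mult.left_commute mult_left_mono order.trans zero_le_one)
  then have "n * c1 \<le> n * (d * (c1 div d))" using ray by simp
  then have "c1 \<le> d * (c1 div d)" using assms(1) by simp
  moreover have "d * (c1 div d) + c1 mod d = c1" by simp
  moreover have "c1 mod d \<ge> 0" using assms(2) by simp
  ultimately have "c1 = d * (c1 div d)" by linarith
  moreover from this have "d * c2 = d * (- n * (c1 div d))" using ray by (metis mult.left_commute)
  then have "c2 = - n * (c1 div d)" using assms(2) mult_cancel_left[of d c2] by force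
  ultimately show ?thesis by blast
qed

text \<open>
  The combinatorial contradiction. Here \<open>(s,l)\<close> is the value of \<open>\<xi>\<close> and \<open>(b1,b2)\<close> the value \<open>\<beta>\<close> of the
  divisor; the hypotheses on \<open>x\<close>, \<open>z\<close> and \<open>y\<close> decompose the values \<open>(0,1)\<close>, \<open>(1,0)\<close> and \<open>(d,-n)\<close> as a
  multiple of \<open>\<beta>\<close>, a part such as \<open>(x1,x2)\<close> parallel to \<open>(s,l)\<close>, and a multiple of \<open>(s,l)\<close>.
\<close>

lemma semigroup_rank_one_quotient_not_cyclic:
  fixes n d s l b1 b2 ix iz iy mx mz my :: int
  assumes nd: "n \<ge> 2" "d \<ge> 2" and s: "s > 0"
    and lb: "l \<ge> - n * (s div d)" and bb: "b2 \<ge> - n * (b1 div d)"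
    and i: "ix \<ge> 0" "iz \<ge> 0" "iy \<ge> 0"
    and x: "0 = ix * b1 + x1 + mx * s" "1 = ix * b2 + x2 + mx * l" 
      "s * x2 = l * x1" "x2 \<ge> - n * (x1 div d)"
    and z: "1 = iz * b1 + z1 + mz * s" "0 = iz * b2 + z2 + mz * l" 
      "s * z2 = l * z1" "z2 \<ge> - n * (z1 div d)"
    and y: "d = iy * b1 + y1 + my * s" "- n = iy * b2 + y2 + my * l" 
      "s * y2 = l * y1"
  shows False
proof -
  define L where "L = s * b2 - l * b1"
  \<comment> \<open>Taking the determinant with \<open>(s,l)\<close> kills the parallel parts.\<close>
  have Lx: "s = ix * L"
  proof -
    have "s * 1 - l * 0 = s * (ix * b2 + x2 + mx * l) - l * (ix * b1 + x1 + mx * s)"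
      using x(1,2) by metis
    also have "\<dots> = ix * L + (s * x2 - l * x1)" unfolding L_def by (simp add: algebra_simps)
    finally show ?thesis using x(3) by simp
  qed
  have Lz: "- l = iz * L"
  proof -
    have "s * 0 - l * 1 = s * (iz * b2 + z2 + mz * l) - l * (iz * b1 + z1 + mz * s)"
      using z(1,2) by metis
    also have "\<dots> = iz * L + (s * z2 - l * z1)" unfolding L_def by (simp add: algebra_simps)
    finally show ?thesis using z(3) by simp
  qed
  have Ly: "- s * n - l * d = iy * L"
  proof -
    have "s * (- n) - l * d = s * (iy * b2 + y2 + my * l) - l * (iy * b1 + y1 + my * s)"
      using y(1,2) by metis
    also have "\<dots> = iy * L + (s * y2 - l * y1)" unfolding L_def by (simp add: algebra_simps)
    finally show ?thesis using y(3) by simp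
  qed
  have L: "L > 0" using Lx s i(1) by (simp add: zero_less_mult_iff)
  have "iy * L \<ge> 0" using L i by simp
  then have 1: "- l * d \<ge> s * n" using Ly by simp
  have "l * d \<ge> - n * (s div d) * d" using lb nd by (intro mult_right_mono) auto
  moreover have "d * (s div d) \<le> s" using nd by (metis add.commute div_mod_decomp_int le_add_same_cancel1 mult.commute pos_mod_sign zless_add1_eq add_increasing order_less_le_trans zero_less_numeral le_add_same_cancel2)
  then have "n * (d * (s div d)) \<le> n * s" using nd by simp
  ultimately have "l * d \<ge> - s * n" by (simp add: algebra_simps)
  with 1 have ld: "d * l = - n * s" by (simp add: algebra_simps)
  obtain j where j: "s = d * j" "l = - n * j"
    using ray_multiple[of n d l s] nd ld lb by auto
  have jpos: "j > 0" using s j nd by (simp add: zero_less_mult_iff)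
  \<comment> \<open>The same determinant with \<open>(d,-n)\<close> instead of its multiple \<open>(s,l)\<close>; it divides both \<open>d\<close> and \<open>n\<close>.\<close>
  define M where "M = d * b2 + n * b1"
  have LM: "L = j * M" unfolding L_def M_def j by (simp add: algebra_simps)
  have Mx: "d = ix * M" using Lx jpos unfolding j LM by (simp add: mult.left_commute[of _ j] mult.commute[of d])
  have Mz: "n = iz * M" using Lz jpos unfolding j LM by (simp add: mult.left_commute[of _ j] mult.commute[of n])
  have Mpos: "M > 0" using L LM jpos by (simp add: zero_less_mult_iff)
  have Mn: "M \<le> n" and Md: "M \<le> d"
    using Mx Mz nd i Mpos by (metis dvd_triv_right zdvd_imp_le zero_less_numeral order_less_le_trans)+
  define q t where "q = b1 div d" and "t = b1 mod d"
  have b1: "b1 = d * q + t" and t: "0 \<le> t" "t < d" using nd by (simp_all add: q_def t_def)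
  have Mt: "M = d * (b2 + n * q) + n * t" unfolding M_def b1 by (simp add: algebra_simps)
  have nonneg: "b2 + n * q \<ge> 0" using bb by (simp add: q_def)
  have "j * (d * x2) = j * (- n * x1)" using x(3) unfolding j by (simp add: algebra_simps)
  then have ray_x: "d * x2 = - n * x1" using jpos by (metis less_irrefl mult_cancel_left)
  obtain kx where kx: "x1 = d * kx" "x2 = - n * kx"
    using ray_multiple[OF _ _ ray_x x(4)] nd by auto
  have "j * (d * z2) = j * (- n * z1)" using z(3) unfolding j by (simp add: algebra_simps)
  then have ray_z: "d * z2 = - n * z1" using jpos by (metis less_irrefl mult_cancel_left)
  obtain kz where kz: "z1 = d * kz" "z2 = - n * kz"
    using ray_multiple[OF _ _ ray_z z(4)] nd by auto
  \<comment> \<open>Since \<open>M \<ge> n t\<close> and \<open>M \<le> n\<close>, only \<open>t \<le> 1\<close> is possible. If \<open>t = 0\<close>, all first components are divisible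
    by \<open>d\<close>, which fails for \<open>z\<close>. If \<open>t = 1\<close>, then \<open>M = n\<close>, and \<open>d\<close> would divide \<open>ix = d / n\<close>.\<close>
  consider "t = 0" | "t = 1" | "t \<ge> 2" using t by linarith
  then show False
  proof cases
    case 1
    have "1 = d * (iz * q + kz + mz * j)" using z(1) unfolding kz b1 1 j by (simp add: algebra_simps)
    then have "d dvd 1" by (rule dvdI)
    then show False using nd by simp
  next
    case 2
    have "0 = ix * (d * q + 1) + d * kx + mx * (d * j)" using x(1) unfolding kx b1 2 j .
    then have "ix = d * (- ix * q - kx - mx * j)" by (simp add: algebra_simps)
    then have "d dvd ix" by (rule dvdI)
    moreover have ix0: "ix > 0" using Lx s i(1) L by (simp add: zero_less_mult_iff)
    ultimately have "d \<le> ix" by (simp add: zdvd_imp_le)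
    moreover have "M \<ge> n" using Mt nonneg nd unfolding 2 by simp
    then have "ix * 2 \<le> ix * M" using nd ix0 by simp
    ultimately show False using Mx nd by linarith
  next
    case 3
    have "n * t \<ge> n * 2" using 3 nd by (intro mult_left_mono) auto
    moreover have "d * (b2 + n * q) \<ge> 0" using nonneg nd by simp
    ultimately show False using Mt Mn nd by linarith
  qed
qed


lemma ev_Z: "ev g \<phi> [:[:0, 1:]:] = [:0, 1:]"
  by (simp add: map_poly_pCons)

lemma ev_Y: "ev g \<phi> [:0, 1:] = y_elem g \<phi>"
  by (simp add: ev_def map_poly_pCons)

lemma (in surface) y_elem_degree:
  "y_elem g \<phi> \<noteq> 0" "zdeg (y_elem g \<phi>) = int (degree \<phi>)" "xdeg (y_elem g \<phi>) = - int (degree g)"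
proof -
  have "\<phi> \<noteq> 0" using monic by auto
  then show "y_elem g \<phi> \<noteq> 0" using g_nonzero by (simp add: y_elem_def)
  show "zdeg (y_elem g \<phi>) = int (degree \<phi>)" using g_nonzero by (simp add: y_elem_def zdeg_def)
  show "xdeg (y_elem g \<phi>) = - int (degree g)"
    using g_nonzero monic by (simp add: y_elem_def xdeg_def fract_degree_inverse)
qed

section \<open>Isomorphisms as homomorphisms into \<open>K(x)[z]\<close>\<close>

text \<open>
  A \<open>K\<close>-isomorphism of the two coordinate rings, presented by its composition with the projection from
  \<open>K[X,Y,Z]\<close> and the embedding into \<open>K(x)[z]\<close>. Injectivity and surjectivity become statements about kernels and ranges,
  and no quotient ring appears.
\<close>

locale surface_iso = dom: surface f \<phi>1 + cod: surface g \<phi>2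
  for f :: "'k::field poly" and \<phi>1 :: "'k poly poly" and g :: "'k poly" and \<phi>2 :: "'k poly poly" +
  fixes \<tau> :: "'k poly poly poly \<Rightarrow> 'k poly fract poly"
  assumes tau_add [simp]: "\<tau> (P + Q) = \<tau> P + \<tau> Q"
    and tau_mult [simp]: "\<tau> (P * Q) = \<tau> P * \<tau> Q"
    and tau_scalar [simp]: "\<tau> [:[:[:c:]:]:] = [:to_fract [:c:]:]"
    and tau_eq_0_iff: "\<tau> P = 0 \<longleftrightarrow> ev f \<phi>1 P = 0"
    and range_tau: "range \<tau> = range (ev g \<phi>2)"
begin

lemma tau_0 [simp]: "\<tau> 0 = 0" by (simp add: tau_eq_0_iff)

lemma tau_uminus [simp]: "\<tau> (- P) = - \<tau> P"
  using tau_add[of P "- P"] by (simp del: tau_add add: eq_neg_iff_add_eq_0 add.commute)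

lemma tau_diff [simp]: "\<tau> (P - Q) = \<tau> P - \<tau> Q"
  using tau_add[of P "- Q"] by simp

lemma tau_eq_iff: "\<tau> P = \<tau> Q \<longleftrightarrow> ev f \<phi>1 P = ev f \<phi>1 Q"
  using tau_eq_0_iff[of "P - Q"] by simp

lemma tau_const_eq_0_iff [simp]: "\<tau> [:h:] = 0 \<longleftrightarrow> h = 0"
  by (simp add: tau_eq_0_iff)

lemma tau_in_range [simp]: "\<tau> P \<in> range (ev g \<phi>2)"
  using range_tau by blast

abbreviation "\<xi> \<equiv> \<tau> [:[:[:0, 1:]:]:]"
abbreviation "\<zeta> \<equiv> \<tau> [:[:0, 1:]:]"

lemma tau_x_pCons: "\<tau> [:[:pCons a c:]:] = [:to_fract [:a:]:] + \<xi> * \<tau> [:[:c:]:]"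
proof -
  have "[:[:pCons a c:]:] = [:[:[:a:]:]:] + [:[:[:0, 1:]:]:] * [:[:c:]:]" by simp
  then show ?thesis by (simp only: tau_add tau_mult tau_scalar)
qed

lemma tau_smult: "\<tau> [:smult a h:] = \<tau> [:[:a:]:] * \<tau> [:h:]"
proof -
  have "[:smult a h:] = [:[:a:]:] * [:h:]" by simp
  then show ?thesis by (simp only: tau_mult)
qed

lemma tau_z_pCons: "\<tau> [:pCons a h:] = \<tau> [:[:a:]:] + \<zeta> * \<tau> [:h:]"
proof -
  have "[:pCons a h:] = [:[:a:]:] + [:[:0, 1:]:] * [:h:]" by simp
  then show ?thesis by (simp only: tau_add tau_mult)
qed

text \<open>If \<open>\<xi>\<close> involves \<open>z\<close>, then the powers of \<open>\<xi>\<close> have distinct degrees and the highest one wins.\<close>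

lemma zdeg_xdeg_tau_x:
  assumes pos: "degree \<xi> > 0" and "c \<noteq> 0"
  shows "zdeg (\<tau> [:[:c:]:]) = int (degree c) * zdeg \<xi> \<and> xdeg (\<tau> [:[:c:]:]) = int (degree c) * xdeg \<xi>"
  using assms(2)
proof (induction c)
  case (pCons a c)
  have xi: "\<xi> \<noteq> 0" by simp
  show ?case
  proof (cases "c = 0")
    case True
    then have a: "a \<noteq> 0" using pCons.hyps by simp
    show ?thesis using True a by (simp add: zdeg_def xdeg_def)
  next
    case False
    define e where "e = \<xi> * \<tau> [:[:c:]:]"
    have e: "e \<noteq> 0" using False by (simp add: e_def)
    have w: "zdeg e = int (degree (pCons a c)) * zdeg \<xi>" "xdeg e = int (degree (pCons a c)) * xdeg \<xi>"
      using False xi pCons.IH by (simp_all add: e_def zdeg_mult xdeg_mult algebra_simps)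
    have "degree e > 0" using xi False pos by (simp add: e_def degree_mult_eq)
    then have "degree ([:to_fract [:a:]:] + e) = degree e"
      and "lead_coeff ([:to_fract [:a:]:] + e) = lead_coeff e"
      by (simp_all add: degree_add_eq_right coeff_eq_0)
    moreover have "\<tau> [:[:pCons a c:]:] = [:to_fract [:a:]:] + e"
      unfolding e_def by (rule tau_x_pCons)
    ultimately show ?thesis using w by (simp only: zdeg_def xdeg_def)
  qed
qed simp

lemma clear_denominator_range:
  assumes "c \<in> range (ev g \<phi>2)"
  shows "\<exists>N h. \<tau> [:[:f ^ N:]:] * c = \<tau> [:h:]"
proof -
  obtain P where c: "c = \<tau> P" using assms range_tau by (metis rangeE)
  obtain N h where "ev f \<phi>1 (smult [:f ^ N:] P) = fract_poly h"
    using dom.clear_denominator by blast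
  then have "ev f \<phi>1 ([:[:f ^ N:]:] * P) = ev f \<phi>1 [:h:]" by simp
  then have "\<tau> ([:[:f ^ N:]:] * P) = \<tau> [:h:]" by (simp only: tau_eq_iff)
  then show ?thesis unfolding c tau_mult by blast
qed

text \<open>
  The determinant of the value of \<open>\<xi>\<close> and the value of \<open>b\<close>. It vanishes iff the two values are parallel, and its
  sign tells on which side of the line through the value of \<open>\<xi>\<close> the value of \<open>b\<close> lies.
\<close>

definition cross :: "'k poly fract poly \<Rightarrow> int" where
  "cross b = zdeg \<xi> * xdeg b - xdeg \<xi> * zdeg b"

lemma cross_mult: "a \<noteq> 0 \<Longrightarrow> b \<noteq> 0 \<Longrightarrow> cross (a * b) = cross a + cross b"
  by (simp add: cross_def zdeg_mult xdeg_mult algebra_simps)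

text \<open>
  Pseudo-division \<open>a h = b q + r\<close> over \<open>K[X]\<close>. The value of \<open>r\<close> is parallel to that of \<open>\<xi>\<close>, while by
  induction the determinant of \<open>b q\<close> is a positive multiple of that of \<open>b\<close>; the two values differ, so the sum
  has one of them. The factor \<open>a\<close> contributes a multiple of the value of \<open>\<xi>\<close>, and so \<open>m\<close> may be negative.
\<close>

lemma value_decomposition:
  assumes xi: "degree \<xi> > 0"
    and minimal: "\<And>r. r \<noteq> 0 \<Longrightarrow> degree r < degree b \<Longrightarrow> cross (\<tau> [:r:]) = 0"
    and b: "b \<noteq> 0" "cross (\<tau> [:b:]) \<noteq> 0"
    and h: "h \<noteq> 0"
  shows "\<exists>i::nat. \<exists>m::int. \<exists>r. r \<noteq> 0 \<and> cross (\<tau> [:r:]) = 0 \<and>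
    zdeg (\<tau> [:h:]) = int i * zdeg (\<tau> [:b:]) + zdeg (\<tau> [:r:]) + m * zdeg \<xi> \<and>
    xdeg (\<tau> [:h:]) = int i * xdeg (\<tau> [:b:]) + xdeg (\<tau> [:r:]) + m * xdeg \<xi>"
  using h
proof (induction "degree h" arbitrary: h rule: less_induct)
  case less
  define r where "r = pseudo_mod h b"
  obtain a q where a: "a \<noteq> 0" and aq: "smult a h = b * q + r"
    using pseudo_mod(1)[OF b(1), of h] by (auto simp: r_def)
  have r: "r = 0 \<or> degree r < degree b" using pseudo_mod(2)[OF b(1), of h] by (simp add: r_def)
  have bpos: "degree b > 0"
  proof (rule ccontr)
    assume "\<not> degree b > 0"
    then obtain c where c: "b = [:c:]" by (metis degree_eq_zeroE gr0I)
    then have "c \<noteq> 0" using b(1) by auto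
    from zdeg_xdeg_tau_x[OF xi this] have "cross (\<tau> [:b:]) = 0" by (simp add: cross_def c)
    with b(2) show False by simp
  qed
  define k where "k = int (degree a)"
  have ah: "zdeg (\<tau> [:smult a h:]) = k * zdeg \<xi> + zdeg (\<tau> [:h:])"
      "xdeg (\<tau> [:smult a h:]) = k * xdeg \<xi> + xdeg (\<tau> [:h:])"
    using zdeg_xdeg_tau_x[OF xi a] a less.prems
    by (simp_all add: tau_smult zdeg_mult xdeg_mult k_def)
  show ?case
  proof (cases "q = 0")
    case True
    then have "r = smult a h" using aq by simp
    moreover from this have "r \<noteq> 0" "cross (\<tau> [:r:]) = 0" using a less.prems r minimal by auto
    ultimately show ?thesis using ah
      by (intro exI[of _ 0] exI[of _ "- k"] exI[of _ r]) simp
  next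
    case False
    have dbq: "degree (b * q) = degree b + degree q" using b False by (simp add: degree_mult_eq)
    have "degree (b * q + r) = degree (b * q)"
      using r dbq degree_add_eq_left[of r "b * q"] by auto
    then have "degree q < degree h" using aq a dbq bpos by (metis degree_smult_eq less_add_same_cancel2)
    from less.hyps[OF this False] obtain i m r' where IH:
      "r' \<noteq> 0" "cross (\<tau> [:r':]) = 0"
      "zdeg (\<tau> [:q:]) = int i * zdeg (\<tau> [:b:]) + zdeg (\<tau> [:r':]) + m * zdeg \<xi>"
      "xdeg (\<tau> [:q:]) = int i * xdeg (\<tau> [:b:]) + xdeg (\<tau> [:r':]) + m * xdeg \<xi>"
      by blast
    define e where "e = \<tau> [:b:] * \<tau> [:q:]"
    have e: "e \<noteq> 0" using b False by (simp add: e_def)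
    have we: "zdeg e = int (Suc i) * zdeg (\<tau> [:b:]) + zdeg (\<tau> [:r':]) + m * zdeg \<xi>"
        "xdeg e = int (Suc i) * xdeg (\<tau> [:b:]) + xdeg (\<tau> [:r':]) + m * xdeg \<xi>"
      using IH b False by (simp_all add: e_def zdeg_mult xdeg_mult algebra_simps)
    have "cross e = int (Suc i) * cross (\<tau> [:b:]) + cross (\<tau> [:r':])"
      unfolding cross_def we by (simp add: algebra_simps)
    then have le: "cross e \<noteq> 0" using IH(2) b(2) by simp
    have split: "\<tau> [:smult a h:] = e + \<tau> [:r:]"
    proof -
      have "[:smult a h:] = [:b:] * [:q:] + [:r:]" using aq by simp
      then show ?thesis by (simp only: tau_add tau_mult e_def)
    qed
    consider (quot) "zdeg (\<tau> [:smult a h:]) = zdeg e" "xdeg (\<tau> [:smult a h:]) = xdeg e"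
      | (remainder) "r \<noteq> 0" "zdeg (\<tau> [:smult a h:]) = zdeg (\<tau> [:r:])" "xdeg (\<tau> [:smult a h:]) = xdeg (\<tau> [:r:])"
    proof (cases "r = 0")
      case True
      then show ?thesis using split e that(1) by simp
    next
      case rnz: False
      have rlt: "degree r < degree b" using r rnz by simp
      have lr: "cross (\<tau> [:r:]) = 0" by (rule minimal[OF rnz rlt])
      have "(zdeg e, xdeg e) \<noteq> (zdeg (\<tau> [:r:]), xdeg (\<tau> [:r:]))"
      proof
        assume "(zdeg e, xdeg e) = (zdeg (\<tau> [:r:]), xdeg (\<tau> [:r:]))"
        then have "cross e = cross (\<tau> [:r:])" by (simp add: cross_def)
        with le lr show False by simp
      qed
      from deg_add[OF e _ this] rnz
      have "(zdeg (\<tau> [:smult a h:]) = zdeg e \<and> xdeg (\<tau> [:smult a h:]) = xdeg e) \<or>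
        (zdeg (\<tau> [:smult a h:]) = zdeg (\<tau> [:r:]) \<and> xdeg (\<tau> [:smult a h:]) = xdeg (\<tau> [:r:]))"
        unfolding split by simp
      then show ?thesis using that rnz by blast
    qed
    then show ?thesis
    proof cases
      case quot
      show ?thesis
      proof (intro exI conjI)
        show "r' \<noteq> 0" "cross (\<tau> [:r':]) = 0" by fact+
        show "zdeg (\<tau> [:h:]) = int (Suc i) * zdeg (\<tau> [:b:]) + zdeg (\<tau> [:r':]) + (m - k) * zdeg \<xi>"
        proof -
          have "zdeg (\<tau> [:h:]) = zdeg e - k * zdeg \<xi>" using quot(1) ah(1) by linarith
          then show ?thesis unfolding we(1) by (simp only: left_diff_distrib)
        qed
        show "xdeg (\<tau> [:h:]) = int (Suc i) * xdeg (\<tau> [:b:]) + xdeg (\<tau> [:r':]) + (m - k) * xdeg \<xi>"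
        proof -
          have "xdeg (\<tau> [:h:]) = xdeg e - k * xdeg \<xi>" using quot(2) ah(2) by linarith
          then show ?thesis unfolding we(2) by (simp only: left_diff_distrib)
        qed
      qed
    next
      case remainder
      show ?thesis
      proof (intro exI conjI)
        show "r \<noteq> 0" by fact
        have "degree r < degree b" using r remainder(1) by simp
        then show "cross (\<tau> [:r:]) = 0" by (rule minimal[OF remainder(1)])
        show "zdeg (\<tau> [:h:]) = int 0 * zdeg (\<tau> [:b:]) + zdeg (\<tau> [:r:]) + (- k) * zdeg \<xi>"
          using remainder(2) ah(1) by simp
        show "xdeg (\<tau> [:h:]) = int 0 * xdeg (\<tau> [:b:]) + xdeg (\<tau> [:r:]) + (- k) * xdeg \<xi>"
          using remainder(3) ah(2) by simp
      qed
    qed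
  qed
qed

end


context surface_iso begin

text \<open>
  Multiplying by a power of \<open>f(\<xi>)\<close> brings every element of the coordinate ring into \<open>K[\<xi>,\<zeta>]\<close> and
  changes its value only by a multiple of the value of \<open>\<xi>\<close>.
\<close>

lemma value_decomposition_range:
  assumes xi: "degree \<xi> > 0"
    and minimal: "\<And>r. r \<noteq> 0 \<Longrightarrow> degree r < degree b \<Longrightarrow> cross (\<tau> [:r:]) = 0"
    and b: "b \<noteq> 0" "cross (\<tau> [:b:]) \<noteq> 0"
    and c: "c \<in> range (ev g \<phi>2)" "c \<noteq> 0"
  obtains i m c1 c2 :: int where "i \<ge> 0"
    "zdeg c = i * zdeg (\<tau> [:b:]) + c1 + m * zdeg \<xi>"
    "xdeg c = i * xdeg (\<tau> [:b:]) + c2 + m * xdeg \<xi>"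
    "zdeg \<xi> * c2 = xdeg \<xi> * c1" "c2 \<ge> - int (degree g) * (c1 div int (degree \<phi>2))"
proof -
  obtain N h where h: "\<tau> [:[:f ^ N:]:] * c = \<tau> [:h:]" using clear_denominator_range[OF c(1)] by blast
  have fN: "f ^ N \<noteq> 0" using dom.g_nonzero by simp
  then have "\<tau> [:[:f ^ N:]:] * c \<noteq> 0" using c by simp
  then have "h \<noteq> 0" using h by auto
  from value_decomposition[OF xi minimal b this] obtain i :: nat and m :: int and r where *:
    "r \<noteq> 0" "cross (\<tau> [:r:]) = 0"
    "zdeg (\<tau> [:h:]) = int i * zdeg (\<tau> [:b:]) + zdeg (\<tau> [:r:]) + m * zdeg \<xi>"
    "xdeg (\<tau> [:h:]) = int i * xdeg (\<tau> [:b:]) + xdeg (\<tau> [:r:]) + m * xdeg \<xi>"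
    by blast
  define k where "k = int (degree (f ^ N))"
  have "zdeg (\<tau> [:h:]) = k * zdeg \<xi> + zdeg c" "xdeg (\<tau> [:h:]) = k * xdeg \<xi> + xdeg c"
    using zdeg_xdeg_tau_x[OF xi fN] fN c h[symmetric] by (simp_all add: zdeg_mult xdeg_mult k_def)
  then have "zdeg c = int i * zdeg (\<tau> [:b:]) + zdeg (\<tau> [:r:]) + (m - k) * zdeg \<xi>"
    "xdeg c = int i * xdeg (\<tau> [:b:]) + xdeg (\<tau> [:r:]) + (m - k) * xdeg \<xi>"
    using * by (simp_all add: algebra_simps)
  moreover have "zdeg \<xi> * xdeg (\<tau> [:r:]) = xdeg \<xi> * zdeg (\<tau> [:r:])" using *(2) by (simp add: cross_def)
  moreover have "xdeg (\<tau> [:r:]) \<ge> - int (degree g) * (zdeg (\<tau> [:r:]) div int (degree \<phi>2))"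
    using cod.xdeg_lower_bound[of "\<tau> [:r:]"] *(1) by simp
  ultimately show ?thesis using that[of "int i"] by simp
qed

text \<open>
  The key step: \<open>x\<^sub>1\<close> is mapped into \<open>K[x\<^sub>2]\<close>. The divisor for the decomposition exists because the value of
  \<open>x\<close> itself is not parallel to that of \<open>\<xi>\<close>.
\<close>

lemma degree_xi_eq_0:
  assumes "degree g \<ge> 2" "degree \<phi>2 \<ge> 2"
  shows "degree \<xi> = 0"
proof (rule ccontr)
  assume "degree \<xi> \<noteq> 0"
  then have xi: "degree \<xi> > 0" by simp
  then have s: "zdeg \<xi> > 0" by (simp add: zdeg_def)
  define x where "x = ev g \<phi>2 [:[:[:0, 1:]:]:]"
  define z where "z = ev g \<phi>2 [:[:0, 1:]:]"
  define y where "y = ev g \<phi>2 [:0, 1:]"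
  have x: "x \<in> range (ev g \<phi>2)" "x \<noteq> 0" "zdeg x = 0" "xdeg x = 1"
    unfolding x_def by (rule rangeI, simp_all add: zdeg_def xdeg_def)
  have z: "z \<in> range (ev g \<phi>2)" unfolding z_def by (rule rangeI)
  have z': "z = [:0, 1:]" unfolding z_def by (rule ev_Z)
  have wz: "z \<noteq> 0" "zdeg z = 1" "xdeg z = 0"
    unfolding z' using fract_degree_to_fract[of "1::'k poly"] by (simp_all add: zdeg_def xdeg_def)
  have y: "y \<in> range (ev g \<phi>2)" unfolding y_def by (rule rangeI)
  have wy: "y \<noteq> 0" "zdeg y = int (degree \<phi>2)" "xdeg y = - int (degree g)"
    unfolding y_def ev_Y by (rule cod.y_elem_degree)+
  have "\<exists>b. b \<noteq> 0 \<and> cross (\<tau> [:b:]) \<noteq> 0"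
  proof -
    obtain N h where h: "\<tau> [:[:f ^ N:]:] * x = \<tau> [:h:]" using clear_denominator_range[OF x(1)] by blast
    have fN: "f ^ N \<noteq> 0" using dom.g_nonzero by simp
    have "cross (\<tau> [:[:f ^ N:]:] * x) = cross x"
      using zdeg_xdeg_tau_x[OF xi fN] fN x by (simp add: cross_mult) (simp add: cross_def)
    moreover have "cross x > 0" using s x by (simp add: cross_def)
    moreover have "h \<noteq> 0" using h x fN by force
    ultimately show ?thesis using h by (intro exI[of _ h]) simp
  qed
  then obtain b where b: "b \<noteq> 0 \<and> cross (\<tau> [:b:]) \<noteq> 0"
    and least: "\<And>r. r \<noteq> 0 \<and> cross (\<tau> [:r:]) \<noteq> 0 \<Longrightarrow> degree b \<le> degree r"
    using exists_least_iff[of "\<lambda>k. \<exists>b. degree b = k \<and> b \<noteq> 0 \<and> cross (\<tau> [:b:]) \<noteq> 0"]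
    by (metis not_le)
  have minimal: "cross (\<tau> [:r:]) = 0" if "r \<noteq> 0" "degree r < degree b" for r
    using least[of r] that by auto
  note decomp = value_decomposition_range[OF xi minimal b[THEN conjunct1] b[THEN conjunct2]]
  obtain ix mx x1 x2 where X: "ix \<ge> 0"
    "zdeg x = ix * zdeg (\<tau> [:b:]) + x1 + mx * zdeg \<xi>"
    "xdeg x = ix * xdeg (\<tau> [:b:]) + x2 + mx * xdeg \<xi>"
    "zdeg \<xi> * x2 = xdeg \<xi> * x1" "x2 \<ge> - int (degree g) * (x1 div int (degree \<phi>2))"
    by (rule decomp[OF _ _ x(1,2)])
  obtain iz mz z1 z2 where Z: "iz \<ge> 0"
    "zdeg z = iz * zdeg (\<tau> [:b:]) + z1 + mz * zdeg \<xi>"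
    "xdeg z = iz * xdeg (\<tau> [:b:]) + z2 + mz * xdeg \<xi>"
    "zdeg \<xi> * z2 = xdeg \<xi> * z1" "z2 \<ge> - int (degree g) * (z1 div int (degree \<phi>2))"
    by (rule decomp[OF _ _ z wz(1)])
  obtain iy my y1 y2 where Y: "iy \<ge> 0"
    "zdeg y = iy * zdeg (\<tau> [:b:]) + y1 + my * zdeg \<xi>"
    "xdeg y = iy * xdeg (\<tau> [:b:]) + y2 + my * xdeg \<xi>"
    "zdeg \<xi> * y2 = xdeg \<xi> * y1"
    by (rule decomp[OF _ _ y wy(1)])
  have bounds: "xdeg \<xi> \<ge> - int (degree g) * (zdeg \<xi> div int (degree \<phi>2))"
    "xdeg (\<tau> [:b:]) \<ge> - int (degree g) * (zdeg (\<tau> [:b:]) div int (degree \<phi>2))"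
    by (rule cod.xdeg_lower_bound, rule tau_in_range, use b in simp)+
  show False
    by (rule semigroup_rank_one_quotient_not_cyclic[OF _ _ s bounds X(1) Z(1) Y(1)
        X(2,3)[unfolded x] X(4,5) Z(2,3)[unfolded wz] Z(4,5) Y(2,3)[unfolded wy] Y(4)])
      (use assms in auto)
qed

end


section \<open>The normal form of an isomorphism\<close>

lemma subst_xz_0 [simp]: "subst_xz 0 a b = 0"
  by (simp add: subst_xz_def)

lemma subst_xz_pCons:
  "subst_xz (pCons c h) [:p:] b = [:pcompose c p:] + b * subst_xz h [:p:] b"
proof -
  have *: "poly (map_poly (\<lambda>k. [:[:k:]:]) c) [:p:] = [:pcompose c p:]" for c :: "'a poly"
    by (induction c) (simp_all add: map_poly_pCons pcompose_pCons)
  show ?thesis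
    unfolding subst_xz_def * by (simp add: map_poly_pCons)
qed

context surface_iso begin

text \<open>The homomorphism that presents the inverse isomorphism.\<close>

definition tau_inv :: "'k poly poly poly \<Rightarrow> 'k poly fract poly" where
  "tau_inv Q = ev f \<phi>1 (SOME P. \<tau> P = ev g \<phi>2 Q)"

lemma tau_inv_eq_iff: "tau_inv Q = ev f \<phi>1 P \<longleftrightarrow> \<tau> P = ev g \<phi>2 Q"
proof -
  have "\<exists>P. \<tau> P = ev g \<phi>2 Q" using range_tau by (metis rangeE rangeI)
  then have *: "\<tau> (SOME P. \<tau> P = ev g \<phi>2 Q) = ev g \<phi>2 Q" by (rule someI_ex)
  show ?thesis unfolding tau_inv_def tau_eq_iff[symmetric] * by auto
qed

lemma tau_surj: obtains P where "\<tau> P = ev g \<phi>2 Q"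
  using range_tau by (metis rangeE rangeI)

lemma surface_iso_inv: "surface_iso g \<phi>2 f \<phi>1 tau_inv"
proof
  show "tau_inv (P + Q) = tau_inv P + tau_inv Q" for P Q
  proof -
    obtain P' Q' where *: "\<tau> P' = ev g \<phi>2 P" "\<tau> Q' = ev g \<phi>2 Q" by (metis tau_surj)
    then have "\<tau> (P' + Q') = ev g \<phi>2 (P + Q)" by simp
    then have "tau_inv (P + Q) = ev f \<phi>1 (P' + Q')" unfolding tau_inv_eq_iff .
    then show ?thesis using *[folded tau_inv_eq_iff] by simp
  qed
  show "tau_inv (P * Q) = tau_inv P * tau_inv Q" for P Q
  proof -
    obtain P' Q' where *: "\<tau> P' = ev g \<phi>2 P" "\<tau> Q' = ev g \<phi>2 Q" by (metis tau_surj)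
    then have "\<tau> (P' * Q') = ev g \<phi>2 (P * Q)" by simp
    then have "tau_inv (P * Q) = ev f \<phi>1 (P' * Q')" unfolding tau_inv_eq_iff .
    then show ?thesis using *[folded tau_inv_eq_iff] by simp
  qed
  show "tau_inv [:[:[:c:]:]:] = [:to_fract [:c:]:]" for c
    using tau_inv_eq_iff[of "[:[:[:c:]:]:]" "[:[:[:c:]:]:]"] by simp
  show "tau_inv P = 0 \<longleftrightarrow> ev g \<phi>2 P = 0" for P
    using tau_inv_eq_iff[of P 0] by (simp add: eq_commute[of 0])
  show "range tau_inv = range (ev f \<phi>1)"
  proof (intro equalityI subsetI)
    fix b assume "b \<in> range (ev f \<phi>1)"
    then obtain P where P: "b = ev f \<phi>1 P" by blast
    obtain Q where "\<tau> P = ev g \<phi>2 Q" using tau_in_range by blast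
    then show "b \<in> range tau_inv" unfolding P by (metis tau_inv_eq_iff rangeI)
  qed (auto simp: tau_inv_def)
qed

lemma tau_x_eq:
  assumes "\<xi> = [:to_fract p:]"
  shows "\<tau> [:[:c:]:] = [:to_fract (pcompose c p):]"
proof (induction c)
  case (pCons a c)
  have "\<tau> [:[:pCons a c:]:] = [:to_fract [:a:]:] + [:to_fract p:] * [:to_fract (pcompose c p):]"
    using tau_x_pCons[of a c] unfolding pCons.IH assms .
  then show ?case by (simp add: pcompose_pCons)
qed simp

lemma tau_xz_eq:
  assumes "\<xi> = [:to_fract p:]" "\<zeta> = fract_poly q"
  shows "\<tau> [:h:] = fract_poly (subst_xz h [:p:] q)"
proof (induction h)
  case (pCons a h)
  have "\<tau> [:pCons a h:] = [:to_fract (pcompose a p):] + fract_poly q * fract_poly (subst_xz h [:p:] q)"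
    using tau_z_pCons[of a h] unfolding pCons.IH tau_x_eq[OF assms(1)] assms(2) .
  then show ?case by (simp add: subst_xz_pCons)
qed simp

lemma xi_polynomial:
  assumes "degree g \<ge> 2" "degree \<phi>2 \<ge> 2"
  obtains p where "\<xi> = [:to_fract p:]"
proof -
  have 0: "degree \<xi> = 0" using degree_xi_eq_0[OF assms] .
  then obtain c where c: "\<xi> = fract_poly c"
    using cod.coord_ring_elem(2)[of \<xi>] assms by auto
  with 0 have "degree c = 0" by simp
  then obtain p where "c = [:p:]" by (elim degree_eq_zeroE)
  with c show ?thesis using that by simp
qed

lemma degree_tau_xz:
  assumes "\<xi> = [:to_fract p:]"
  shows "degree (\<tau> [:h:]) = degree h * degree \<zeta>"
proof (induction h)
  case (pCons a h)
  have eq: "\<tau> [:pCons a h:] = [:to_fract (pcompose a p):] + \<zeta> * \<tau> [:h:]"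
    using tau_z_pCons[of a h] unfolding tau_x_eq[OF assms(1)] .
  show ?case
  proof (cases "h = 0")
    case True
    then show ?thesis using eq by simp
  next
    case False
    have z: "\<zeta> \<noteq> 0" by simp
    have "degree (\<zeta> * \<tau> [:h:]) = degree (pCons a h) * degree \<zeta>"
      using False z pCons.IH by (simp add: degree_mult_eq)
    moreover have "degree ([:to_fract (pcompose a p):] + b) = degree b" for b
      by (cases b) simp
    ultimately show ?thesis unfolding eq by simp
  qed
qed simp

text \<open>
  Some multiple of \<open>z\<close> by a nonzero element of \<open>K[x]\<close> is a polynomial in \<open>\<zeta>\<close> over \<open>K[x]\<close>, of degree 1 in \<open>z\<close>; hence the degree of
  \<open>\<zeta>\<close> divides 1.
\<close>

lemma degree_zeta:
  assumes "\<xi> = [:to_fract p:]"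
  shows "degree \<zeta> = 1"
proof -
  obtain N h where h: "\<tau> [:[:f ^ N:]:] * ev g \<phi>2 [:[:0, 1:]:] = \<tau> [:h:]"
    using clear_denominator_range by blast
  have "degree (\<tau> [:[:f ^ N:]:]) = 0" using tau_x_eq[OF assms] by simp
  moreover have "\<tau> [:[:f ^ N:]:] \<noteq> 0" using dom.g_nonzero by simp
  ultimately have "degree (\<tau> [:h:]) = 1" unfolding h[symmetric] ev_Z by (simp add: degree_mult_eq)
  then show ?thesis using degree_tau_xz[OF assms, of h] by simp
qed

lemma zeta_linear:
  assumes "\<xi> = [:to_fract p:]" "degree \<phi>2 \<ge> 2"
  obtains \<gamma> \<delta> where "\<zeta> = fract_poly [:\<delta>, \<gamma>:]" "\<gamma> \<noteq> 0"
proof -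
  have 1: "degree \<zeta> = 1" using degree_zeta[OF assms(1)] .
  then obtain c where c: "\<zeta> = fract_poly c"
    using cod.coord_ring_elem(2)[of \<zeta>] assms by auto
  with 1 have dc: "degree c = 1" by simp
  obtain \<delta> c' where c': "c = pCons \<delta> c'" by (cases c)
  with dc have "degree c' = 0" "c' \<noteq> 0" by (auto split: if_splits)
  then obtain \<gamma> where "c' = [:\<gamma>:]" "\<gamma> \<noteq> 0" by (auto elim!: degree_eq_zeroE)
  then show ?thesis using that c c' by blast
qed

text \<open>
  The polynomials that describe \<open>T\<close> on \<open>x\<^sub>1\<close> and its inverse on \<open>x\<^sub>2\<close> compose to the identity, so both are linear. The
  leading coefficients of the images of \<open>z\<^sub>1\<close> and \<open>z\<^sub>2\<close> are inverse to each other after substitution, so they are constants.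
\<close>

lemma linear_forms:
  assumes "degree f \<ge> 2" "degree \<phi>1 \<ge> 2" "degree g \<ge> 2" "degree \<phi>2 \<ge> 2"
  obtains l \<mu> \<gamma> \<delta> where "l \<noteq> 0" "\<gamma> \<noteq> 0" "\<xi> = [:to_fract [:\<mu>, l:]:]" "\<zeta> = fract_poly [:\<delta>, [:\<gamma>:]:]"
proof -
  interpret inv: surface_iso g \<phi>2 f \<phi>1 tau_inv by (rule surface_iso_inv)
  obtain p where p: "\<xi> = [:to_fract p:]" using xi_polynomial[OF assms(3,4)] .
  obtain p' where p': "tau_inv [:[:[:0, 1:]:]:] = [:to_fract p':]" using inv.xi_polynomial[OF assms(1,2)] .
  then have "tau_inv [:[:[:0, 1:]:]:] = ev f \<phi>1 [:[:p':]:]" by simp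
  then have "\<tau> [:[:p':]:] = [:to_fract [:0, 1:]:]" unfolding tau_inv_eq_iff by simp
  then have comp: "pcompose p' p = [:0, 1:]" unfolding tau_x_eq[OF p] by simp
  then have "degree p' * degree p = 1" using degree_pcompose[of p' p] by simp
  then have "degree p = 1" by simp
  moreover obtain \<mu> c where pc: "p = pCons \<mu> c" by (cases p)
  ultimately have "degree c = 0" "c \<noteq> 0" by (auto split: if_splits)
  then obtain l where l: "c = [:l:]" "l \<noteq> 0" by (auto elim!: degree_eq_zeroE)
  obtain \<gamma> \<delta> where z: "\<zeta> = fract_poly [:\<delta>, \<gamma>:]" "\<gamma> \<noteq> 0" using zeta_linear[OF p assms(4)] .
  obtain \<gamma>' \<delta>' where z': "tau_inv [:[:0, 1:]:] = fract_poly [:\<delta>', \<gamma>':]"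
    using inv.zeta_linear[OF p' assms(2)] .
  then have "tau_inv [:[:0, 1:]:] = ev f \<phi>1 [:[:\<delta>', \<gamma>':]:]" by simp
  then have "\<tau> [:[:\<delta>', \<gamma>':]:] = fract_poly [:0, 1:]" unfolding tau_inv_eq_iff by simp
  then have "subst_xz [:\<delta>', \<gamma>':] [:p:] [:\<delta>, \<gamma>:] = [:0, 1:]"
    unfolding tau_xz_eq[OF p z(1)] by (simp only: fract_poly_eq_iff)
  then have "pcompose \<gamma>' p * \<gamma> = 1" by (simp add: subst_xz_pCons)
  then have "is_unit \<gamma>" by (metis dvd_triv_right)
  then obtain k where k: "\<gamma> = [:k:]" unfolding is_unit_poly_iff by blast
  with z(2) have k0: "k \<noteq> 0" by auto
  show ?thesis using that[OF l(2) k0] p z pc l k by simp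
qed

lemma lead_coeff_subst_xz:
  assumes "lead_coeff h = 1" "\<gamma> \<noteq> 0"
  shows "degree (subst_xz h [:p:] [:\<delta>, [:\<gamma>:]:]) = degree h"
    and "lead_coeff (subst_xz h [:p:] [:\<delta>, [:\<gamma>:]:]) = [:\<gamma> ^ degree h:]"
proof -
  have "degree (subst_xz h [:p:] [:\<delta>, [:\<gamma>:]:]) = degree h \<and>
    lead_coeff (subst_xz h [:p:] [:\<delta>, [:\<gamma>:]:]) = [:\<gamma> ^ degree h:]"
    using assms(1)
  proof (induction h)
    case (pCons a h)
    show ?case
    proof (cases "h = 0")
      case True
      then have "a = 1" using pCons.prems by simp
      moreover have "subst_xz (pCons a h) [:p:] [:\<delta>, [:\<gamma>:]:] = [:pcompose a p:]"
        using True by (simp only: subst_xz_pCons subst_xz_0 mult_zero_right add_0_right)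
      ultimately show ?thesis using True by (simp add: pcompose_1)
    next
      case False
      define e where "e = subst_xz h [:p:] [:\<delta>, [:\<gamma>:]:]"
      have lh: "lead_coeff h = 1" using pCons.prems False by simp
      then have IH: "degree e = degree h" "lead_coeff e = [:\<gamma> ^ degree h:]"
        using pCons.IH unfolding e_def by blast+
      define b where "b = [:\<delta>, [:\<gamma>:]:] * e"
      have e0: "e \<noteq> 0" using IH(2) assms(2) by auto
      have l: "[:\<delta>, [:\<gamma>:]:] \<noteq> 0" "degree [:\<delta>, [:\<gamma>:]:] = 1" "lead_coeff [:\<delta>, [:\<gamma>:]:] = [:\<gamma>:]"
        using assms(2) by simp_all
      have db: "degree b = Suc (degree h)" unfolding b_def degree_mult_eq[OF l(1) e0] l(2) IH(1) by simp
      have lb: "lead_coeff b = [:\<gamma> ^ Suc (degree h):]"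
        unfolding b_def lead_coeff_mult l(3) IH(2) by simp
      have eq: "subst_xz (pCons a h) [:p:] [:\<delta>, [:\<gamma>:]:] = [:pcompose a p:] + b"
        by (simp only: subst_xz_pCons b_def e_def)
      have lt: "degree [:pcompose a p:] < degree b" using db by simp
      have "degree ([:pcompose a p:] + b) = degree (pCons a h)"
        using degree_add_eq_right[OF lt] db False by simp
      moreover have "lead_coeff ([:pcompose a p:] + b) = [:\<gamma> ^ degree (pCons a h):]"
        unfolding degree_pCons_eq[OF False] by (rule trans[OF lead_coeff_add_le[OF lt] lb])
      ultimately show ?thesis unfolding eq by (rule conjI)
    qed
  qed simp
  then show "degree (subst_xz h [:p:] [:\<delta>, [:\<gamma>:]:]) = degree h"
    and "lead_coeff (subst_xz h [:p:] [:\<delta>, [:\<gamma>:]:]) = [:\<gamma> ^ degree h:]"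
    by blast+
qed

text \<open>The relation \<open>f(x\<^sub>1) y\<^sub>1 = \<phi>1(x\<^sub>1,z\<^sub>1)\<close>, transported by the isomorphism.\<close>

lemma tau_y:
  assumes "\<xi> = [:to_fract p:]" "\<zeta> = fract_poly q"
  shows "smult (to_fract (pcompose f p)) (\<tau> [:0, 1:]) = fract_poly (subst_xz \<phi>1 [:p:] q)"
proof -
  have "rel f \<phi>1 = [:0, 1:] * [:[:f:]:] - [:\<phi>1:]" by (simp add: rel_def)
  then have "\<tau> (rel f \<phi>1) = \<tau> [:0, 1:] * \<tau> [:[:f:]:] - \<tau> [:\<phi>1:]" by (simp only: tau_diff tau_mult)
  moreover have "\<tau> (rel f \<phi>1) = 0" unfolding tau_eq_0_iff by simp
  ultimately show ?thesis
    by (simp add: tau_x_eq[OF assms(1), of f] tau_xz_eq[OF assms, of \<phi>1] mult.commute)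
qed

lemma y_value:
  assumes p: "\<xi> = [:to_fract p:]" "\<zeta> = fract_poly [:\<delta>, [:\<gamma>:]:]" "\<gamma> \<noteq> 0" and fp: "pcompose f p \<noteq> 0"
  shows "degree (\<tau> [:0, 1:]) = degree \<phi>1"
    and "lead_coeff (\<tau> [:0, 1:]) = to_fract [:\<gamma> ^ degree \<phi>1:] / to_fract (pcompose f p)"
proof -
  define \<upsilon> where "\<upsilon> = \<tau> [:0, 1:]"
  note eq = tau_y[OF p(1,2), folded \<upsilon>_def]
  note lc = lead_coeff_subst_xz[OF dom.monic p(3), of p \<delta>]
  have "degree \<upsilon> = degree (smult (to_fract (pcompose f p)) \<upsilon>)" using fp by simp
  also have "\<dots> = degree \<phi>1" unfolding eq by (simp add: lc)
  finally show "degree (\<tau> [:0, 1:]) = degree \<phi>1" by (simp add: \<upsilon>_def)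
  have "to_fract (pcompose f p) * lead_coeff \<upsilon> = lead_coeff (smult (to_fract (pcompose f p)) \<upsilon>)" by simp
  also have "\<dots> = to_fract [:\<gamma> ^ degree \<phi>1:]" unfolding eq using lc by simp
  finally show "lead_coeff (\<tau> [:0, 1:]) = to_fract [:\<gamma> ^ degree \<phi>1:] / to_fract (pcompose f p)"
    using fp by (simp add: \<upsilon>_def field_simps)
qed

text \<open>
  The image of \<open>y\<^sub>1\<close> has \<open>z\<close>-degree \<open>deg \<phi>1\<close> and a genuine denominator in its leading coefficient, while elements of
  degree below \<open>deg \<phi>2\<close> have none.
\<close>

lemma degree_le:
  assumes p: "\<xi> = [:to_fract p:]" "\<zeta> = fract_poly [:\<delta>, [:\<gamma>:]:]" "\<gamma> \<noteq> 0"
    and fp: "degree (pcompose f p) > 0"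
  shows "degree \<phi>2 \<le> degree \<phi>1"
proof (rule ccontr)
  assume lt: "\<not> degree \<phi>2 \<le> degree \<phi>1"
  have fp0: "pcompose f p \<noteq> 0" using fp by auto
  note y = y_value[OF p fp0]
  from lt have "degree (\<tau> [:0, 1:]) < degree \<phi>2" using y(1) by simp
  then obtain c where "\<tau> [:0, 1:] = fract_poly c"
    using cod.coord_ring_elem(2)[of "\<tau> [:0, 1:]"] lt by (cases "\<tau> [:0, 1:] = 0") (auto intro: that[of 0])
  then have "to_fract (lead_coeff c * pcompose f p) = to_fract [:\<gamma> ^ degree \<phi>1:]"
    using y(2) fp0 by (simp add: field_simps)
  then have "pcompose f p dvd [:\<gamma> ^ degree \<phi>1:]" by (metis dvd_triv_right to_fract_eq_iff)
  moreover have "[:\<gamma> ^ degree \<phi>1:] \<noteq> 0" using p(3) by simp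
  ultimately have "degree (pcompose f p) \<le> 0" by (metis dvd_imp_degree_le degree_pCons_0)
  with fp show False by simp
qed

text \<open>In degree \<open>deg \<phi>2\<close> the denominator of a leading coefficient divides \<open>g\<close>, up to a constant.\<close>

lemma pcompose_dvd:
  assumes p: "\<xi> = [:to_fract p:]" "\<zeta> = fract_poly [:\<delta>, [:\<gamma>:]:]" "\<gamma> \<noteq> 0"
    and fp: "pcompose f p \<noteq> 0" and eq: "degree \<phi>1 = degree \<phi>2"
  shows "pcompose f p dvd g"
proof -
  note y = y_value[OF p fp]
  have "\<tau> [:0, 1:] \<noteq> 0" using y(1) dom.degree_pos by auto
  then obtain r where "lead_coeff (\<tau> [:0, 1:]) * to_fract g ^ (degree (\<tau> [:0, 1:]) div degree \<phi>2) = to_fract r"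
    using cod.coord_ring_elem(1)[of "\<tau> [:0, 1:]"] by auto
  then have "to_fract [:\<gamma> ^ degree \<phi>1:] / to_fract (pcompose f p) * to_fract g = to_fract r"
    unfolding y(2) unfolding y(1) eq using cod.degree_pos by simp
  then have "to_fract ([:\<gamma> ^ degree \<phi>1:] * g) = to_fract (r * pcompose f p)"
    using fp unfolding to_fract_mult by (simp add: field_simps)
  then have "smult (\<gamma> ^ degree \<phi>1) g = r * pcompose f p" by (simp only: to_fract_eq_iff) simp
  then show ?thesis using p(3) by (metis dvd_smult_cancel dvd_triv_right power_not_zero)
qed

text \<open>
  With \<open>c = u\<inverse> \<gamma>\<^sup>d\<close> the elements \<open>\<tau> Y\<close> and \<open>c y\<close> have the same degree \<open>d\<close> and the same leading coefficient, so
  their difference \<open>\<nu>\<close> has degree below \<open>d\<close> and lies in \<open>K[x,z]\<close>. Multiplying by \<open>u g\<close> yields the formula for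
  \<open>\<phi>1(\<lambda>x + \<mu>, \<gamma>z + \<delta>)\<close> with \<open>\<theta> = u \<nu>\<close>.
\<close>

lemma isomorphism_normal_form:
  assumes deg: "degree f \<ge> 2" "degree \<phi>1 \<ge> 2" "degree g \<ge> 2" "degree \<phi>2 \<ge> 2"
  obtains l \<mu> \<gamma> \<delta> u \<theta> where "l \<noteq> 0" "\<gamma> \<noteq> 0" "u \<noteq> 0"
    "\<xi> = [:to_fract [:\<mu>, l:]:]" "\<zeta> = fract_poly [:\<delta>, [:\<gamma>:]:]"
    "pcompose f [:\<mu>, l:] = smult u g" "degree \<phi>1 = degree \<phi>2"
    "subst_xz \<phi>1 [:[:\<mu>, l:]:] [:\<delta>, [:\<gamma>:]:] = smult [:\<gamma> ^ degree \<phi>2:] \<phi>2 + smult g \<theta>"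
    "degree \<theta> \<le> degree \<phi>2 - 1"
    "\<tau> [:0, 1:] = ev g \<phi>2 [:smult [:inverse u:] \<theta>, [:[:inverse u * \<gamma> ^ degree \<phi>2:]:]:]"
proof -
  interpret inv: surface_iso g \<phi>2 f \<phi>1 tau_inv by (rule surface_iso_inv)
  obtain l \<mu> \<gamma> \<delta> where 1: "l \<noteq> 0" "\<gamma> \<noteq> 0" "\<xi> = [:to_fract [:\<mu>, l:]:]" "\<zeta> = fract_poly [:\<delta>, [:\<gamma>:]:]"
    using linear_forms[OF deg] .
  obtain l' \<mu>' \<gamma>' \<delta>' where 2: "l' \<noteq> 0" "\<gamma>' \<noteq> 0"
    "tau_inv [:[:[:0, 1:]:]:] = [:to_fract [:\<mu>', l':]:]"
    "tau_inv [:[:0, 1:]:] = fract_poly [:\<delta>', [:\<gamma>':]:]"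
    using inv.linear_forms[OF deg(3,4,1,2)] .
  define p where "p = [:\<mu>, l:]"
  define p' where "p' = [:\<mu>', l':]"
  have dp: "degree p = 1" "degree p' = 1" using 1 2 by (simp_all add: p_def p'_def)
  then have df: "degree (pcompose f p) = degree f" "degree (pcompose g p') = degree g"
    by (simp_all add: degree_pcompose)
  have f0: "pcompose f p \<noteq> 0" "pcompose g p' \<noteq> 0"
    using df deg by (metis degree_0 not_numeral_le_zero)+
  note 1 = 1(1,2) 1(3,4)[folded p_def]
  note 2 = 2(1,2) 2(3,4)[folded p'_def]
  have eqd: "degree \<phi>1 = degree \<phi>2"
    using degree_le[OF 1(3,4,2)] inv.degree_le[OF 2(3,4,2)] df deg by simp
  have fg: "pcompose f p dvd g" by (rule pcompose_dvd[OF 1(3,4,2) f0(1) eqd])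
  have gf: "pcompose g p' dvd f" by (rule inv.pcompose_dvd[OF 2(3,4,2) f0(2) eqd[symmetric]])
  have "degree g \<le> degree f"
    using dvd_imp_degree_le[OF gf] dom.g_nonzero df by simp
  obtain k where k: "g = pcompose f p * k" using fg by (elim dvdE)
  then have "k \<noteq> 0" using cod.g_nonzero by auto
  then have "degree g = degree f + degree k" using k f0 df by (simp add: degree_mult_eq)
  with \<open>degree g \<le> degree f\<close> obtain v where v: "k = [:v:]" by (metis add_le_same_cancel1 degree_eq_zeroE le_zero_eq)
  then have v0: "v \<noteq> 0" using \<open>k \<noteq> 0\<close> by auto
  define u where "u = inverse v"
  have u0: "u \<noteq> 0" using v0 by (simp add: u_def)
  have fu: "pcompose f p = smult u g" using k v v0 by (simp add: u_def)
  define d where "d = degree \<phi>2"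
  note y = y_value[OF 1(3,4,2) f0(1), unfolded eqd fu, folded d_def]
  define c where "c = inverse u * \<gamma> ^ d"
  have c0: "c \<noteq> 0" using 1 u0 by (simp add: c_def)
  define e where "e = \<tau> [:0, 1:] - smult (to_fract [:c:]) (y_elem g \<phi>2)"
  have range_e: "e \<in> range (ev g \<phi>2)"
  proof -
    obtain Q where "\<tau> [:0, 1:] = ev g \<phi>2 Q" using tau_in_range by blast
    then have "e = ev g \<phi>2 (Q - [:[:[:c:]:]:] * [:0, 1:])" unfolding e_def ev_diff ev_mult ev_Y by simp
    then show ?thesis by blast
  qed
  have y2: "degree (y_elem g \<phi>2) = d" "lead_coeff (y_elem g \<phi>2) = inverse (to_fract g)"
    using cod.g_nonzero cod.monic by (simp_all add: y_elem_def d_def)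
  have split: "to_fract (smult u g) = to_fract [:u:] * to_fract g" 
    unfolding to_fract_mult[symmetric] by simp
  have uc: "to_fract [:u:] * to_fract [:c:] = to_fract [:\<gamma> ^ d:]"
    unfolding to_fract_mult[symmetric] using u0 by (simp add: c_def)
  have "coeff e d = 0"
  proof -
    have "coeff (\<tau> [:0, 1:]) d = to_fract [:\<gamma> ^ d:] / (to_fract [:u:] * to_fract g)"
      using y split by simp
    also have "\<dots> = to_fract [:c:] * inverse (to_fract g)"
      using uc u0 cod.g_nonzero by (simp add: uc[symmetric] field_simps)
    finally show ?thesis using y2 unfolding e_def by simp
  qed
  moreover have "degree e \<le> d"
    unfolding e_def by (intro degree_diff_le) (use y y2 c0 in simp_all)
  ultimately have "degree e < d" using deg(4) d_def
    by (metis degree_0 leading_coeff_0_iff le_neq_implies_less not_numeral_le_zero gr0I)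
  then obtain \<nu> where \<nu>: "e = fract_poly \<nu>" and d\<nu>: "degree \<nu> < d"
    using cod.coord_ring_elem(2)[OF range_e] unfolding d_def
    by (cases "e = 0") (fastforce intro: that[of 0])+
  define \<theta> where "\<theta> = smult [:u:] \<nu>"
  have \<nu>\<theta>: "\<nu> = smult [:inverse u:] \<theta>" using u0 by (simp add: \<theta>_def one_pCons[symmetric])
  have ty: "\<tau> [:0, 1:] = fract_poly \<nu> + smult (to_fract [:c:]) (y_elem g \<phi>2)"
    using \<nu> unfolding e_def by (simp add: algebra_simps)
  have gy: "smult (to_fract g) (y_elem g \<phi>2) = fract_poly \<phi>2"
    using cod.g_nonzero by (simp add: y_elem_def)
  have "fract_poly (subst_xz \<phi>1 [:p:] [:\<delta>, [:\<gamma>:]:]) = smult (to_fract (smult u g)) (\<tau> [:0, 1:])"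
    using tau_y[OF 1(3,4)] unfolding fu by simp
  also have "\<dots> = smult (to_fract g) (smult (to_fract [:u:]) (fract_poly \<nu>))
      + smult (to_fract [:u:] * to_fract [:c:]) (smult (to_fract g) (y_elem g \<phi>2))"
    unfolding ty split by (simp add: smult_add_right mult_ac)
  also have "\<dots> = fract_poly (smult [:\<gamma> ^ d:] \<phi>2 + smult g \<theta>)"
    unfolding uc gy by (simp add: \<theta>_def split mult.commute)
  finally have sub: "subst_xz \<phi>1 [:p:] [:\<delta>, [:\<gamma>:]:] = smult [:\<gamma> ^ d:] \<phi>2 + smult g \<theta>"
    by (simp only: fract_poly_eq_iff)
  have d\<theta>: "degree \<theta> \<le> d - 1" using d\<nu> degree_smult_le[of "[:u:]" \<nu>] by (simp add: \<theta>_def)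
  have ty': "\<tau> [:0, 1:] = ev g \<phi>2 [:smult [:inverse u:] \<theta>, [:[:c:]:]:]"
    unfolding ty \<nu>\<theta>[symmetric] by simp
  show ?thesis
    using that[OF 1(1,2) u0 1(3,4)[unfolded p_def] fu[unfolded p_def] eqd sub[unfolded p_def d_def]
        d\<theta>[unfolded d_def] ty'[unfolded c_def d_def]] .
qed

end


context surface_iso begin

lemma subst_xz_mult:
  assumes "\<xi> = [:to_fract p:]" "\<zeta> = fract_poly q"
  shows "subst_xz (a * b) [:p:] q = subst_xz a [:p:] q * subst_xz b [:p:] q"
proof -
  have "\<tau> ([:a:] * [:b:]) = \<tau> [:a:] * \<tau> [:b:]" by (rule tau_mult)
  then have "\<tau> [:a * b:] = \<tau> [:a:] * \<tau> [:b:]" by (simp add: mult.commute)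
  then show ?thesis unfolding tau_xz_eq[OF assms] fract_poly_mult[symmetric] fract_poly_eq_iff .
qed

lemma subst_xz_add:
  assumes "\<xi> = [:to_fract p:]" "\<zeta> = fract_poly q"
  shows "subst_xz (a + b) [:p:] q = subst_xz a [:p:] q + subst_xz b [:p:] q"
proof -
  have "\<tau> ([:a:] + [:b:]) = \<tau> [:a:] + \<tau> [:b:]" by (rule tau_add)
  then have "\<tau> [:a + b:] = \<tau> [:a:] + \<tau> [:b:]" by simp
  then show ?thesis unfolding tau_xz_eq[OF assms] fract_poly_add[symmetric] fract_poly_eq_iff .
qed

lemma subst_xz_smult:
  assumes "\<xi> = [:to_fract p:]" "\<zeta> = fract_poly q"
  shows "subst_xz (smult c b) [:p:] q = smult (pcompose c p) (subst_xz b [:p:] q)"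
  using subst_xz_mult[OF assms, of "[:c:]" b] by (simp add: subst_xz_pCons[of c 0])

text \<open>Both \<open>T\<close> and its inverse map \<open>K[x,z]\<close> into \<open>K[x,z]\<close>, by their linear forms.\<close>

lemma subst_xz_surj:
  assumes deg: "degree f \<ge> 2" "degree \<phi>1 \<ge> 2" "degree g \<ge> 2" "degree \<phi>2 \<ge> 2"
    and pq: "\<xi> = [:to_fract p:]" "\<zeta> = fract_poly q"
  obtains h' where "subst_xz h' [:p:] q = h"
proof -
  interpret inv: surface_iso g \<phi>2 f \<phi>1 tau_inv by (rule surface_iso_inv)
  obtain l \<mu> \<gamma> \<delta> where "tau_inv [:[:[:0, 1:]:]:] = [:to_fract [:\<mu>, l:]:]"
    "tau_inv [:[:0, 1:]:] = fract_poly [:\<delta>, [:\<gamma>:]:]"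
    using inv.linear_forms[OF deg(3,4,1,2)] .
  from inv.tau_xz_eq[OF this, of h] obtain h' where "tau_inv [:h:] = fract_poly h'" by blast
  then have "tau_inv [:h:] = ev f \<phi>1 [:h':]" by simp
  then have "\<tau> [:h':] = ev g \<phi>2 [:h:]" unfolding tau_inv_eq_iff .
  then have "fract_poly (subst_xz h' [:p:] q) = fract_poly h" unfolding tau_xz_eq[OF pq] by simp
  then show ?thesis using that by (simp only: fract_poly_eq_iff)
qed

end

section \<open>Comparing prime factorizations\<close>

lemma prime_elem_dvd_prod:
  fixes r :: "'a::comm_semiring_1"
  assumes "finite A" "prime_elem r" "r dvd prod h A"
  shows "\<exists>i\<in>A. r dvd h i"
  using assms(1,3)
proof (induction A)
  case empty
  then show ?case using assms(2) prime_elem_not_unit by auto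
next
  case (insert i A)
  then show ?case using prime_elem_dvd_multD[OF assms(2)] by auto
qed

text \<open>
  A prime \<open>r\<close> that divides the product is associated with some \<open>q j\<close>, and then it divides no other factor, so the
  whole power \<open>r ^ k\<close> divides \<open>q j ^ \<beta> j\<close>.
\<close>

lemma prime_power_dvd_prod_prime_powers:
  fixes r :: "'k::field poly"
  assumes "finite A" and r: "prime_elem r" and "k \<ge> 1" and "b \<noteq> 0"
    and q: "\<And>j. j \<in> A \<Longrightarrow> prime_elem (q j)"
    and non_assoc: "\<And>i j. i \<in> A \<Longrightarrow> j \<in> A \<Longrightarrow> i \<noteq> j \<Longrightarrow> \<not> (q i dvd q j \<and> q j dvd q i)"
    and dvd: "r ^ k dvd smult b (\<Prod>j\<in>A. q j ^ \<beta> j)"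
  shows "\<exists>j\<in>A. r dvd q j \<and> q j dvd r \<and> k \<le> \<beta> j"
proof -
  have dvd': "r ^ k dvd (\<Prod>j\<in>A. q j ^ \<beta> j)" using dvd \<open>b \<noteq> 0\<close> by (simp add: dvd_smult_iff)
  have "r dvd r ^ k" using \<open>k \<ge> 1\<close> by (simp add: dvd_power)
  then have "r dvd (\<Prod>j\<in>A. q j ^ \<beta> j)" using dvd' by (rule dvd_trans)
  then obtain j where j: "j \<in> A" "r dvd q j ^ \<beta> j"
    using prime_elem_dvd_prod[OF _ r] \<open>finite A\<close> by (meson finite_Diff)
  then have rq: "r dvd q j" using r by (metis prime_elem_dvd_power)
  have assoc: "q i dvd r" if "i \<in> A" "r dvd q i" for i
    using that r q[OF that(1)] by (metis irreducibleD' prime_elem_imp_irreducible prime_elem_not_unit)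
  have rest: "\<not> r dvd (\<Prod>i\<in>A - {j}. q i ^ \<beta> i)"
  proof
    assume "r dvd (\<Prod>i\<in>A - {j}. q i ^ \<beta> i)"
    then obtain i where i: "i \<in> A - {j}" "r dvd q i ^ \<beta> i"
      using prime_elem_dvd_prod[OF _ r] \<open>finite A\<close> by (meson finite_Diff)
    then have "r dvd q i" using r by (metis prime_elem_dvd_power)
    moreover from this have "q i dvd r" "q j dvd r" using i j rq assoc by auto
    ultimately have "q i dvd q j" "q j dvd q i" using rq by (meson dvd_trans)+
    then show False using non_assoc[of i j] i j by blast
  qed
  have "(\<Prod>i\<in>A. q i ^ \<beta> i) = q j ^ \<beta> j * (\<Prod>i\<in>A - {j}. q i ^ \<beta> i)"
    using \<open>finite A\<close> j(1) by (rule prod.remove)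
  then have "r ^ k dvd (\<Prod>i\<in>A - {j}. q i ^ \<beta> i) * q j ^ \<beta> j" using dvd' by (metis mult.commute)
  moreover have "k > 0" using \<open>k \<ge> 1\<close> by simp
  ultimately have "r ^ k dvd q j ^ \<beta> j" using rest by (rule prime_power_dvd_multD[OF r])
  moreover have "q j ^ k dvd r ^ k" using assoc[OF j(1) rq] by (rule dvd_power_same)
  ultimately have "q j ^ k dvd q j ^ \<beta> j" by (metis dvd_trans)
  then have "k \<le> \<beta> j"
    using q[OF j(1)] by (metis dvd_power_iff prime_elem_not_unit prime_elem_not_zeroI prime_elem_imp_nonzero)
  then show ?thesis using j rq assoc by blast
qed

text \<open>
  Matching each prime power with one on the other side only gives \<open>\<alpha> i \<le> \<beta> j\<close>. Matching back leads
  to the same \<open>i\<close>, because the factors are pairwise non-associated, and gives the converse inequality.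
\<close>

lemma prime_factorization_match:
  fixes P Q :: "nat \<Rightarrow> 'k::field poly"
  assumes fin: "finite A" "finite B" and ab: "a \<noteq> 0" "b \<noteq> 0"
    and eq: "smult a (\<Prod>i\<in>A. P i ^ \<alpha> i) = smult b (\<Prod>j\<in>B. Q j ^ \<beta> j)"
    and P: "\<And>i. i \<in> A \<Longrightarrow> prime_elem (P i) \<and> \<alpha> i \<ge> 1"
    and P': "\<And>i j. i \<in> A \<Longrightarrow> j \<in> A \<Longrightarrow> i \<noteq> j \<Longrightarrow> \<not> (P i dvd P j \<and> P j dvd P i)"
    and Q: "\<And>j. j \<in> B \<Longrightarrow> prime_elem (Q j) \<and> \<beta> j \<ge> 1"
    and Q': "\<And>i j. i \<in> B \<Longrightarrow> j \<in> B \<Longrightarrow> i \<noteq> j \<Longrightarrow> \<not> (Q i dvd Q j \<and> Q j dvd Q i)"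
  shows "\<forall>i\<in>A. \<exists>j\<in>B. P i dvd Q j \<and> Q j dvd P i \<and> \<alpha> i = \<beta> j" and "card A \<le> card B"
proof -
  have P_Q: "\<exists>j\<in>B. P i dvd Q j \<and> Q j dvd P i \<and> \<alpha> i \<le> \<beta> j" if i: "i \<in> A" for i
  proof (rule prime_power_dvd_prod_prime_powers)
    have "P i ^ \<alpha> i dvd (\<Prod>i\<in>A. P i ^ \<alpha> i)" using fin(1) i by (rule dvd_prodI)
    then show "P i ^ \<alpha> i dvd smult b (\<Prod>j\<in>B. Q j ^ \<beta> j)" unfolding eq[symmetric] by (rule dvd_smult)
  qed (use fin ab P i Q Q' in auto)
  have Q_P: "\<exists>i\<in>A. Q j dvd P i \<and> P i dvd Q j \<and> \<beta> j \<le> \<alpha> i" if j: "j \<in> B" for j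
  proof (rule prime_power_dvd_prod_prime_powers)
    have "Q j ^ \<beta> j dvd (\<Prod>j\<in>B. Q j ^ \<beta> j)" using fin(2) j by (rule dvd_prodI)
    then show "Q j ^ \<beta> j dvd smult a (\<Prod>i\<in>A. P i ^ \<alpha> i)" unfolding eq by (rule dvd_smult)
  qed (use fin ab P j Q P' in auto)
  show match: "\<forall>i\<in>A. \<exists>j\<in>B. P i dvd Q j \<and> Q j dvd P i \<and> \<alpha> i = \<beta> j"
  proof
    fix i assume i: "i \<in> A"
    then obtain j where j: "j \<in> B" "P i dvd Q j" "Q j dvd P i" "\<alpha> i \<le> \<beta> j" using P_Q by blast
    then obtain i' where i': "i' \<in> A" "Q j dvd P i'" "P i' dvd Q j" "\<beta> j \<le> \<alpha> i'" using Q_P by blast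
    have "P i dvd P i'" "P i' dvd P i" using i' j by (meson dvd_trans)+
    then have "i' = i" using P'[OF i i'(1)] by blast
    then show "\<exists>j\<in>B. P i dvd Q j \<and> Q j dvd P i \<and> \<alpha> i = \<beta> j" using j i' by force
  qed
  then obtain s where s: "\<forall>i\<in>A. s i \<in> B \<and> P i dvd Q (s i) \<and> Q (s i) dvd P i" by metis
  have "inj_on s A"
  proof (rule inj_onI)
    fix i i' assume i: "i \<in> A" "i' \<in> A" "s i = s i'"
    then have "P i dvd P i'" "P i' dvd P i" using s by (metis dvd_trans)+
    then show "i = i'" using P'[OF i(1,2)] by blast
  qed
  then show "card A \<le> card B" using s fin(2) by (intro card_inj_on_le[of s]) auto
qed

lemma pcompose_dvd_pcompose: "a dvd b \<Longrightarrow> pcompose a p dvd pcompose b p"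
  by (auto elim!: dvdE simp: pcompose_mult)

lemma linear_inverse:
  fixes \<mu> l :: "'k::field"
  assumes "l \<noteq> 0"
  obtains p' where "pcompose [:\<mu>, l:] p' = [:0, 1:]" "pcompose p' [:\<mu>, l:] = [:0, 1:]"
  using that[of "[:- \<mu> / l, 1 / l:]"] assms by (simp add: pcompose_pCons)

lemma pcompose_linear_dvd_iff:
  fixes \<mu> l :: "'k::field"
  assumes "l \<noteq> 0"
  shows "pcompose a [:\<mu>, l:] dvd pcompose b [:\<mu>, l:] \<longleftrightarrow> a dvd b"
proof
  obtain p' where p': "pcompose [:\<mu>, l:] p' = [:0, 1:]" using linear_inverse[OF assms] .
  assume "pcompose a [:\<mu>, l:] dvd pcompose b [:\<mu>, l:]"
  from pcompose_dvd_pcompose[OF this, of p'] show "a dvd b"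
    by (simp only: pcompose_assoc[symmetric] p' pcompose_idR)
qed (rule pcompose_dvd_pcompose)

lemma prime_elem_pcompose_linear:
  fixes \<mu> l :: "'k::field"
  assumes "l \<noteq> 0" and c: "prime_elem c"
  shows "prime_elem (pcompose c [:\<mu>, l:])"
proof (rule prime_elemI)
  let ?p = "[:\<mu>, l:]"
  obtain p' where p': "pcompose p' ?p = [:0, 1:]" using linear_inverse[OF assms(1)] .
  have surj: "pcompose (pcompose a p') ?p = a" for a
    by (simp only: pcompose_assoc[symmetric] p' pcompose_idR)
  note dvd_iff = pcompose_linear_dvd_iff[OF assms(1)]
  have "\<not> 0 dvd c" using c by auto
  then show "pcompose c ?p \<noteq> 0" using dvd_iff[of 0 \<mu> c] by auto
  show "\<not> is_unit (pcompose c ?p)"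
    using dvd_iff[of c \<mu> 1] c prime_elem_not_unit by (simp add: pcompose_1)
  show "pcompose c ?p dvd a \<or> pcompose c ?p dvd b" if "pcompose c ?p dvd a * b" for a b
  proof -
    have "pcompose c ?p dvd pcompose (pcompose a p' * pcompose b p') ?p"
      using that by (simp only: pcompose_mult surj)
    then have "c dvd pcompose a p' * pcompose b p'" by (simp only: dvd_iff)
    then have "c dvd pcompose a p' \<or> c dvd pcompose b p'" using c by (metis prime_elem_dvd_multD)
    then show ?thesis by (metis dvd_iff surj)
  qed
qed

lemma associated_imp_smult:
  fixes a b :: "'k::field poly"
  assumes "a dvd b" "b dvd a" "a \<noteq> 0"
  obtains c where "c \<noteq> 0" "a = smult c b"
proof -
  obtain k where k: "a = b * k" using assms(2) by (elim dvdE)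
  have "b \<noteq> 0" "k \<noteq> 0" using k assms by auto
  then have "degree a = degree b + degree k" using k by (simp add: degree_mult_eq)
  moreover have "degree a \<le> degree b" using assms \<open>b \<noteq> 0\<close> by (intro dvd_imp_degree_le)
  ultimately obtain c where "k = [:c:]" by (metis add_le_same_cancel1 degree_eq_zeroE le_zero_eq)
  then show ?thesis using that[of c] k \<open>k \<noteq> 0\<close> by auto
qed

section \<open>Quotient rings and generated ideals\<close>

lemma ring_of_type_algebra_simps [simp]:
  "carrier ring_of_type_algebra = UNIV"
  "a \<otimes>\<^bsub>ring_of_type_algebra\<^esub> b = a * b"
  "a \<oplus>\<^bsub>ring_of_type_algebra\<^esub> b = a + b"
  "\<one>\<^bsub>ring_of_type_algebra\<^esub> = 1"
  "\<zero>\<^bsub>ring_of_type_algebra\<^esub> = 0"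
  by (simp_all add: ring_of_type_algebra_def)

text \<open>
  The image of a commutative ring under a homomorphism is a ring in which the ideal of two elements
  consists of their linear combinations; this describes both ideals of \<open>K[x,z]\<close> in the theorem.
\<close>

lemma genideal_pair_image:
  fixes h :: "'a::comm_ring_1 \<Rightarrow> 'b" and S :: "'b ring"
  assumes "ring S" and h: "h \<in> ring_hom ring_of_type_algebra S"
  shows "genideal (S\<lparr>carrier := range h\<rparr>) {h a, h b} = {h (a * x + b * y) | x y. True}"
proof -
  let ?R = "ring_of_type_algebra :: 'a ring" and ?S = "S\<lparr>carrier := range h\<rparr>"
  let ?I = "{h (a * x + b * y) | x y. True}"
  interpret R: ring ?R by (rule ring_from_type_algebra)
  interpret S: ring S by fact
  interpret h: ring_hom_ring ?R S h using h by unfold_locales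
  have "ring ?S" using h.img_is_ring by simp
  then interpret S': ring ?S .
  have mult: "h x \<otimes>\<^bsub>?S\<^esub> h y = h (x * y)" for x y using ring_hom_mult[OF h, of x y] by simp
  have add: "h x \<oplus>\<^bsub>?S\<^esub> h y = h (x + y)" for x y using ring_hom_add[OF h, of x y] by simp
  have zero: "\<zero>\<^bsub>?S\<^esub> = h 0" using h.hom_zero by simp
  have ideal: "ideal ?I ?S"
  proof (rule idealI)
    show "subgroup ?I (add_monoid ?S)"
    proof
      show "?I \<subseteq> carrier (add_monoid ?S)" by auto
      show "u \<otimes>\<^bsub>add_monoid ?S\<^esub> v \<in> ?I" if "u \<in> ?I" "v \<in> ?I" for u v
      proof -
        from that obtain x y x' y' where "u = h (a * x + b * y)" "v = h (a * x' + b * y')" by blast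
        then have "u \<oplus>\<^bsub>?S\<^esub> v = h (a * (x + x') + b * (y + y'))"
          by (simp only: add) (simp add: algebra_simps)
        then show ?thesis by auto
      qed
      have "\<zero>\<^bsub>?S\<^esub> = h (a * 0 + b * 0)" using zero by simp
      then have "\<zero>\<^bsub>?S\<^esub> \<in> ?I" by blast
      then show "\<one>\<^bsub>add_monoid ?S\<^esub> \<in> ?I" by simp
      show "inv\<^bsub>add_monoid ?S\<^esub> u \<in> ?I" if u: "u \<in> ?I" for u
      proof -
        from that obtain x y where u: "u = h (a * x + b * y)" by blast
        have "h (a * (- x) + b * (- y)) \<oplus>\<^bsub>?S\<^esub> u = \<zero>\<^bsub>?S\<^esub>"
          unfolding u add zero by (simp add: algebra_simps)
        then have "\<ominus>\<^bsub>?S\<^esub> u = h (a * (- x) + b * (- y))"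
          using u by (intro S'.minus_equality) auto
        then show ?thesis unfolding a_inv_def by blast
      qed
    qed
    show "x \<otimes>\<^bsub>?S\<^esub> u \<in> ?I" if "u \<in> ?I" "x \<in> carrier ?S" for u x
    proof -
      from that obtain z v w where "x = h z" "u = h (a * v + b * w)" by auto
      then have "x \<otimes>\<^bsub>?S\<^esub> u = h (a * (z * v) + b * (z * w))"
        by (simp only: mult) (simp add: algebra_simps)
      then show ?thesis by blast
    qed
    show "u \<otimes>\<^bsub>?S\<^esub> x \<in> ?I" if "u \<in> ?I" "x \<in> carrier ?S" for u x
    proof -
      from that obtain z v w where "x = h z" "u = h (a * v + b * w)" by auto
      then have "u \<otimes>\<^bsub>?S\<^esub> x = h (a * (z * v) + b * (z * w))"
        by (simp only: mult) (simp add: algebra_simps)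
      then show ?thesis by blast
    qed
  qed fact
  have "h a = h (a * 1 + b * 0)" "h b = h (a * 0 + b * 1)" by simp_all
  then have gen: "{h a, h b} \<subseteq> ?I" by blast
  show ?thesis
  proof
    show "genideal ?S {h a, h b} \<subseteq> ?I" using ideal gen by (rule S'.genideal_minimal)
    show "?I \<subseteq> genideal ?S {h a, h b}"
    proof
      fix u assume "u \<in> ?I"
      then obtain x y where u: "u = h (a * x + b * y)" by blast
      have "u = (h a \<otimes>\<^bsub>?S\<^esub> h x) \<oplus>\<^bsub>?S\<^esub> (h b \<otimes>\<^bsub>?S\<^esub> h y)" unfolding mult add u ..
      moreover have ide: "ideal (genideal ?S {h a, h b}) ?S" by (rule S'.genideal_ideal) auto
      moreover have "{h a, h b} \<subseteq> genideal ?S {h a, h b}" by (rule S'.genideal_self) auto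
      ultimately show "u \<in> genideal ?S {h a, h b}"
        using ideal.I_r_closed[OF ide] additive_subgroup.a_closed[OF ideal.axioms(1)[OF ide]] by simp
    qed
  qed
qed

context surface begin

lemma surf_ideal_eq: "surf_ideal g \<phi> = {Q. rel g \<phi> dvd Q}"
proof -
  interpret cring "ring_of_type_algebra :: 'k poly poly poly ring" by (rule cring_from_type_algebra)
  show ?thesis
    unfolding surf_ideal_def rel_def[symmetric]
    using cgenideal_eq_genideal[of "rel g \<phi>"] by (auto simp: cgenideal_def dvd_def mult.commute)
qed

lemma surf_ideal_ideal: "ideal (surf_ideal g \<phi>) ring_of_type_algebra"
proof -
  interpret ring "ring_of_type_algebra :: 'k poly poly poly ring" by (rule ring_from_type_algebra)
  show ?thesis unfolding surf_ideal_def by (rule genideal_ideal) simp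
qed

lemma cls_hom: "cls g \<phi> \<in> ring_hom ring_of_type_algebra (surf g \<phi>)"
proof -
  have "cls g \<phi> = (+>\<^bsub>ring_of_type_algebra\<^esub>) (surf_ideal g \<phi>)" by (rule ext) (simp add: cls_def)
  then show ?thesis unfolding surf_def using ideal.rcos_ring_hom[OF surf_ideal_ideal] by simp
qed

lemma ring_surf: "ring (surf g \<phi>)"
  unfolding surf_def by (rule ideal.quotient_is_ring[OF surf_ideal_ideal])

lemma cls_mult: "cls g \<phi> P \<otimes>\<^bsub>surf g \<phi>\<^esub> cls g \<phi> Q = cls g \<phi> (P * Q)"
  using ring_hom_mult[OF cls_hom, of P Q] by simp

lemma cls_add: "cls g \<phi> P \<oplus>\<^bsub>surf g \<phi>\<^esub> cls g \<phi> Q = cls g \<phi> (P + Q)"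
  using ring_hom_add[OF cls_hom, of P Q] by simp

lemma cls_eq: "cls g \<phi> P = {Q. rel g \<phi> dvd Q - P}"
proof -
  have "(\<exists>h. rel g \<phi> dvd h \<and> Q = h + P) \<longleftrightarrow> rel g \<phi> dvd Q - P" for Q
    by (metis add_diff_cancel diff_add_cancel)
  then show ?thesis
    unfolding cls_def a_r_coset_def' surf_ideal_eq set_eq_iff by simp
qed

lemma cls_eq_iff: "cls g \<phi> P = cls g \<phi> Q \<longleftrightarrow> ev g \<phi> P = ev g \<phi> Q"
  unfolding cls_eq ev_eq_iff[symmetric] set_eq_iff mem_Collect_eq by metis

lemma carrier_surf: "carrier (surf g \<phi>) = range (cls g \<phi>)"
  unfolding surf_def FactRing_def A_RCOSETS_def' by (auto simp: cls_def)

lemma at_xz_hom: "at_xz g \<phi> \<in> ring_hom ring_of_type_algebra (surf g \<phi>)"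
  unfolding at_xz_def
  by (rule ring_hom_memI) (simp_all add: carrier_surf cls_mult cls_add one_pCons[symmetric] mult.commute
      ring_hom_one[OF cls_hom, simplified])

lemma genideal_sub_xz:
  "genideal (sub_xz g \<phi>) {at_x g \<phi> g, at_xz g \<phi> \<phi>} = {at_xz g \<phi> (smult g x + \<phi> * y) | x y. True}"
  using genideal_pair_image[OF ring_surf at_xz_hom, of "[:g:]" \<phi>]
  by (simp add: sub_xz_def at_x_def at_xz_def)

end


text \<open>The passage from an isomorphism of the quotient rings to its presentation in \<open>K(x)[z]\<close>.\<close>

lemma surf_iso_imp_surface_iso:
  assumes "surface f \<phi>1" "surface g \<phi>2" and T: "T \<in> surf_iso f \<phi>1 g \<phi>2"
  obtains \<tau> where "surface_iso f \<phi>1 g \<phi>2 \<tau>"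
    "\<And>P Q. T (cls f \<phi>1 P) = cls g \<phi>2 Q \<longleftrightarrow> \<tau> P = ev g \<phi>2 Q"
proof -
  interpret dom: surface f \<phi>1 by fact
  interpret cod: surface g \<phi>2 by fact
  have hom: "T \<in> ring_hom (surf f \<phi>1) (surf g \<phi>2)"
    and bij: "bij_betw T (carrier (surf f \<phi>1)) (carrier (surf g \<phi>2))"
    and scal: "T (scal f \<phi>1 c) = scal g \<phi>2 c" for c
    using T by (auto simp: surf_iso_def ring_iso_def)
  define \<tau> where "\<tau> P = ev g \<phi>2 (SOME Q. T (cls f \<phi>1 P) = cls g \<phi>2 Q)" for P
  have iff: "T (cls f \<phi>1 P) = cls g \<phi>2 Q \<longleftrightarrow> \<tau> P = ev g \<phi>2 Q" for P Q
  proof -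
    have "\<exists>Q. T (cls f \<phi>1 P) = cls g \<phi>2 Q"
      using bij unfolding bij_betw_def dom.carrier_surf cod.carrier_surf by blast
    then have "T (cls f \<phi>1 P) = cls g \<phi>2 (SOME Q. T (cls f \<phi>1 P) = cls g \<phi>2 Q)" by (rule someI_ex)
    then show ?thesis unfolding \<tau>_def by (metis cod.cls_eq_iff)
  qed
  have ex: "\<exists>Q. \<tau> P = ev g \<phi>2 Q" for P unfolding \<tau>_def by blast
  have scalar: "\<tau> [:[:[:c:]:]:] = [:to_fract [:c:]:]" for c
    using scal[of c] unfolding scal_def iff by simp
  have "surface_iso f \<phi>1 g \<phi>2 \<tau>"
  proof
    fix P Q
    obtain P' Q' where PQ: "\<tau> P = ev g \<phi>2 P'" "\<tau> Q = ev g \<phi>2 Q'" using ex by blast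
    then have TPQ: "T (cls f \<phi>1 P) = cls g \<phi>2 P'" "T (cls f \<phi>1 Q) = cls g \<phi>2 Q'" by (simp_all only: iff)
    have "T (cls f \<phi>1 (P + Q)) = cls g \<phi>2 (P' + Q')"
      unfolding dom.cls_add[symmetric] cod.cls_add[symmetric] TPQ[symmetric]
      by (rule ring_hom_add[OF hom]) (auto simp: dom.carrier_surf)
    then show "\<tau> (P + Q) = \<tau> P + \<tau> Q" unfolding iff PQ by simp
    have "T (cls f \<phi>1 (P * Q)) = cls g \<phi>2 (P' * Q')"
      unfolding dom.cls_mult[symmetric] cod.cls_mult[symmetric] TPQ[symmetric]
      by (rule ring_hom_mult[OF hom]) (auto simp: dom.carrier_surf)
    then show "\<tau> (P * Q) = \<tau> P * \<tau> Q" unfolding iff PQ by simp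
  next
    show "\<tau> [:[:[:c:]:]:] = [:to_fract [:c:]:]" for c by (rule scalar)
  next
    fix P
    have "T (cls f \<phi>1 0) = cls g \<phi>2 0" unfolding iff using scalar[of 0] by simp
    then have "\<tau> P = ev g \<phi>2 0 \<longleftrightarrow> T (cls f \<phi>1 P) = T (cls f \<phi>1 0)" unfolding iff[symmetric] by simp
    also have "\<dots> \<longleftrightarrow> cls f \<phi>1 P = cls f \<phi>1 0"
      using bij unfolding bij_betw_def dom.carrier_surf by (metis inj_on_eq_iff rangeI)
    finally show "\<tau> P = 0 \<longleftrightarrow> ev f \<phi>1 P = 0" unfolding dom.cls_eq_iff by simp
  next
    show "range \<tau> = range (ev g \<phi>2)"
    proof (intro equalityI subsetI)
      fix e assume "e \<in> range (ev g \<phi>2)"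
      then obtain Q where Q: "e = ev g \<phi>2 Q" by blast
      have "T ` range (cls f \<phi>1) = range (cls g \<phi>2)"
        using bij unfolding bij_betw_def dom.carrier_surf cod.carrier_surf by (rule conjunct2)
      then have "cls g \<phi>2 Q \<in> T ` range (cls f \<phi>1)" by (simp only: rangeI)
      then obtain P where "T (cls f \<phi>1 P) = cls g \<phi>2 Q" by (elim imageE) simp
      then show "e \<in> range \<tau>" unfolding iff Q by (metis rangeI)
    qed (use ex in auto)
  qed
  then show ?thesis using iff that by blast
qed

section \<open>Isomorphisms of the surfaces\<close>

theorem theorem4p1:
  fixes f g :: "'k::field poly"
    and \<phi>1 \<phi>2 :: "'k poly poly"
    and d1 d2 n m :: nat
    and p q :: "nat \<Rightarrow> 'k poly"
    and \<alpha> \<beta> :: "nat \<Rightarrow> nat"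
    and a b :: 'k
    and T :: "'k poly poly poly set \<Rightarrow> 'k poly poly poly set"
  assumes "degree f \<ge> 2" and "degree g \<ge> 2"
    and "lead_coeff \<phi>1 = 1" and "lead_coeff \<phi>2 = 1"
    and "d1 = degree \<phi>1" and "d2 = degree \<phi>2"
    and "d1 \<ge> 2" and "d2 \<ge> 2"
    and "a \<noteq> 0" and "f = smult a (\<Prod>i\<in>{1..n}. p i ^ \<alpha> i)"
    and "\<forall>i\<in>{1..n}. prime_elem (p i) \<and> \<alpha> i \<ge> 1"
    and "\<forall>i\<in>{1..n}. \<forall>j\<in>{1..n}. i \<noteq> j \<longrightarrow> \<not> (p i dvd p j \<and> p j dvd p i)"
    and "b \<noteq> 0" and "g = smult b (\<Prod>j\<in>{1..m}. q j ^ \<beta> j)"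
    and "\<forall>j\<in>{1..m}. prime_elem (q j) \<and> \<beta> j \<ge> 1"
    and "\<forall>i\<in>{1..m}. \<forall>j\<in>{1..m}. i \<noteq> j \<longrightarrow> \<not> (q i dvd q j \<and> q j dvd q i)"
    and "T \<in> surf_iso f \<phi>1 g \<phi>2"
  shows "\<exists>lam \<mu> \<gamma> :: 'k. \<exists>\<delta> :: 'k poly. \<exists>u :: 'k. \<exists>\<theta> :: 'k poly poly.
    \<comment> \<open>(i)\<close>
    lam \<noteq> 0 \<and> \<gamma> \<noteq> 0
    \<and> T (gen_x f \<phi>1) =
        scal g \<phi>2 lam \<otimes>\<^bsub>surf g \<phi>2\<^esub> gen_x g \<phi>2 \<oplus>\<^bsub>surf g \<phi>2\<^esub> scal g \<phi>2 \<mu>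
    \<and> T (gen_z f \<phi>1) =
        scal g \<phi>2 \<gamma> \<otimes>\<^bsub>surf g \<phi>2\<^esub> gen_z g \<phi>2 \<oplus>\<^bsub>surf g \<phi>2\<^esub> at_x g \<phi>2 \<delta>
    \<and> n = m
    \<comment> \<open>(ii)\<close>
    \<and> (\<forall>i\<in>{1..n}. \<exists>j\<in>{1..n}. \<exists>\<mu>ij. \<mu>ij \<noteq> 0
        \<and> T (at_x f \<phi>1 (p i)) = scal g \<phi>2 \<mu>ij \<otimes>\<^bsub>surf g \<phi>2\<^esub> at_x g \<phi>2 (q j)
        \<and> \<alpha> i = \<beta> j)
    \<comment> \<open>(iii)\<close>
    \<and> u \<noteq> 0
    \<and> T (at_x f \<phi>1 f) = scal g \<phi>2 u \<otimes>\<^bsub>surf g \<phi>2\<^esub> at_x g \<phi>2 g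
    \<comment> \<open>(iv)\<close>
    \<and> d1 = d2
    \<comment> \<open>(v)\<close>
    \<and> T ` genideal (sub_xz f \<phi>1) {at_x f \<phi>1 f, at_xz f \<phi>1 \<phi>1}
        = genideal (sub_xz g \<phi>2) {at_x g \<phi>2 g, at_xz g \<phi>2 \<phi>2}
    \<comment> \<open>(vi)\<close>
    \<and> T (at_xz f \<phi>1 \<phi>1) = at_xz g \<phi>2 (subst_xz \<phi>1 [:[:\<mu>, lam:]:] [:\<delta>, [:\<gamma>:]:])
    \<and> at_xz g \<phi>2 (subst_xz \<phi>1 [:[:\<mu>, lam:]:] [:\<delta>, [:\<gamma>:]:]) =
        scal g \<phi>2 (\<gamma> ^ d2) \<otimes>\<^bsub>surf g \<phi>2\<^esub> at_xz g \<phi>2 \<phi>2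
          \<oplus>\<^bsub>surf g \<phi>2\<^esub> at_x g \<phi>2 g \<otimes>\<^bsub>surf g \<phi>2\<^esub> at_xz g \<phi>2 \<theta>
    \<and> degree \<theta> \<le> d2 - 1
    \<comment> \<open>(vii)\<close>
    \<and> T (gen_y f \<phi>1) =
        scal g \<phi>2 (inverse u * \<gamma> ^ d2) \<otimes>\<^bsub>surf g \<phi>2\<^esub> gen_y g \<phi>2
          \<oplus>\<^bsub>surf g \<phi>2\<^esub> scal g \<phi>2 (inverse u) \<otimes>\<^bsub>surf g \<phi>2\<^esub> at_xz g \<phi>2 \<theta>"
proof -
  have dom: "surface f \<phi>1" and cod: "surface g \<phi>2"
    using assms(1-8) by (auto intro!: surface.intro)
  interpret cod: surface g \<phi>2 by (rule cod)
  obtain \<tau> where iso: "surface_iso f \<phi>1 g \<phi>2 \<tau>"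
    and T_iff: "\<And>P Q. T (cls f \<phi>1 P) = cls g \<phi>2 Q \<longleftrightarrow> \<tau> P = ev g \<phi>2 Q"
    using surf_iso_imp_surface_iso[OF dom cod assms(17)] by blast
  interpret surface_iso f \<phi>1 g \<phi>2 \<tau> by (rule iso)
  have degs: "degree f \<ge> 2" "degree \<phi>1 \<ge> 2" "degree g \<ge> 2" "degree \<phi>2 \<ge> 2"
    using assms(1-8) by simp_all
  obtain lam \<mu> \<gamma> \<delta> u \<theta> where nf: "lam \<noteq> 0" "\<gamma> \<noteq> 0" "u \<noteq> 0"
    "\<xi> = [:to_fract [:\<mu>, lam:]:]" "\<zeta> = fract_poly [:\<delta>, [:\<gamma>:]:]"
    "pcompose f [:\<mu>, lam:] = smult u g" "degree \<phi>1 = degree \<phi>2"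
    "subst_xz \<phi>1 [:[:\<mu>, lam:]:] [:\<delta>, [:\<gamma>:]:] = smult [:\<gamma> ^ degree \<phi>2:] \<phi>2 + smult g \<theta>"
    "degree \<theta> \<le> degree \<phi>2 - 1"
    "\<tau> [:0, 1:] = ev g \<phi>2 [:smult [:inverse u:] \<theta>, [:[:inverse u * \<gamma> ^ degree \<phi>2:]:]:]"
    using isomorphism_normal_form[OF degs] .
  define s where "s h = subst_xz h [:[:\<mu>, lam:]:] [:\<delta>, [:\<gamma>:]:]" for h
  note s_mult = subst_xz_mult[OF nf(4,5), folded s_def]
  note s_add = subst_xz_add[OF nf(4,5), folded s_def]
  note s_smult = subst_xz_smult[OF nf(4,5), folded s_def]
  have T_xz: "T (at_xz f \<phi>1 h) = at_xz g \<phi>2 (s h)" for h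
    unfolding at_xz_def T_iff tau_xz_eq[OF nf(4,5)] s_def by simp
  have T_x: "T (at_x f \<phi>1 c) = at_x g \<phi>2 (pcompose c [:\<mu>, lam:])" for c
    unfolding at_x_def T_iff tau_x_eq[OF nf(4)] by simp
  note to_cls = gen_x_def gen_y_def gen_z_def scal_def at_x_def at_xz_def cod.cls_mult cod.cls_add

  have i_x: "T (gen_x f \<phi>1) = scal g \<phi>2 lam \<otimes>\<^bsub>surf g \<phi>2\<^esub> gen_x g \<phi>2 \<oplus>\<^bsub>surf g \<phi>2\<^esub> scal g \<phi>2 \<mu>"
    using nf(4) unfolding to_cls T_iff by simp
  have i_z: "T (gen_z f \<phi>1) = scal g \<phi>2 \<gamma> \<otimes>\<^bsub>surf g \<phi>2\<^esub> gen_z g \<phi>2 \<oplus>\<^bsub>surf g \<phi>2\<^esub> at_x g \<phi>2 \<delta>"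
    using nf(5) unfolding to_cls T_iff by simp

  have fac: "smult a (\<Prod>i\<in>{1..n}. pcompose (p i) [:\<mu>, lam:] ^ \<alpha> i) = smult (u * b) (\<Prod>j\<in>{1..m}. q j ^ \<beta> j)"
  proof -
    have "pcompose (r ^ k) [:\<mu>, lam:] = pcompose r [:\<mu>, lam:] ^ k" for r :: "'k poly" and k
      by (induction k) (simp_all add: pcompose_1 pcompose_mult)
    then show ?thesis
      using nf(6) unfolding assms(10,14) pcompose_smult pcompose_prod by simp
  qed
  note P = prime_elem_pcompose_linear[OF nf(1)] and P_dvd = pcompose_linear_dvd_iff[OF nf(1)]
  have ub: "u * b \<noteq> 0" using nf(3) assms(13) by simp
  have match: "\<forall>i\<in>{1..n}. \<exists>j\<in>{1..m}. pcompose (p i) [:\<mu>, lam:] dvd q j \<and> q j dvd pcompose (p i) [:\<mu>, lam:] \<and> \<alpha> i = \<beta> j"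
    and nm: "card {1..n} \<le> card {1..m}"
    using prime_factorization_match[OF _ _ assms(9) ub fac] assms(11,12,15,16) P P_dvd by auto
  have mn: "card {1..m} \<le> card {1..n}"
    using prime_factorization_match(2)[OF _ _ ub assms(9) fac[symmetric]] assms(11,12,15,16) P P_dvd by auto
  have n_eq_m: "n = m" using nm mn by simp
  have ii: "\<exists>j\<in>{1..n}. \<exists>\<mu>ij. \<mu>ij \<noteq> 0
        \<and> T (at_x f \<phi>1 (p i)) = scal g \<phi>2 \<mu>ij \<otimes>\<^bsub>surf g \<phi>2\<^esub> at_x g \<phi>2 (q j)
        \<and> \<alpha> i = \<beta> j" if i: "i \<in> {1..n}" for i
  proof -
    obtain j where j: "j \<in> {1..n}" "pcompose (p i) [:\<mu>, lam:] dvd q j" "q j dvd pcompose (p i) [:\<mu>, lam:]" "\<alpha> i = \<beta> j"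
      using match i unfolding n_eq_m by blast
    have "pcompose (p i) [:\<mu>, lam:] \<noteq> 0" using P assms(11) i by (metis not_prime_elem_zero)
    from associated_imp_smult[OF j(2,3) this] obtain c where
      "c \<noteq> 0" "pcompose (p i) [:\<mu>, lam:] = smult c (q j)" .
    then show ?thesis using j(1,4) unfolding T_x by (auto simp: to_cls)
  qed
  have iii: "T (at_x f \<phi>1 f) = scal g \<phi>2 u \<otimes>\<^bsub>surf g \<phi>2\<^esub> at_x g \<phi>2 g"
    unfolding T_x nf(6) unfolding to_cls by simp

  define k where "k = \<gamma> ^ degree \<phi>2"
  have k: "k \<noteq> 0" using nf(2) by (simp add: k_def)
  have s_phi: "s \<phi>1 = smult [:k:] \<phi>2 + smult g \<theta>" using nf(8) by (simp only: s_def k_def)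
  \<comment> \<open>The generators \<open>f\<close> and \<open>\<phi>1\<close> go to \<open>u g\<close> and \<open>\<gamma>\<^sup>d \<phi>2 + g \<theta>\<close>: a triangular change of generators with unit diagonal.\<close>
  have s_comb: "s (smult f x + \<phi>1 * y) =
      smult g (smult [:u:] (s x) + \<theta> * s y) + \<phi>2 * smult [:k:] (s y)" for x y
    unfolding s_add s_mult s_smult nf(6) s_phi by (simp add: algebra_simps smult_add_right)
  have v: "T ` genideal (sub_xz f \<phi>1) {at_x f \<phi>1 f, at_xz f \<phi>1 \<phi>1}
        = genideal (sub_xz g \<phi>2) {at_x g \<phi>2 g, at_xz g \<phi>2 \<phi>2}"
    unfolding surface.genideal_sub_xz[OF dom] surface.genideal_sub_xz[OF cod]
  proof (intro equalityI subsetI)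
    fix e assume "e \<in> T ` {at_xz f \<phi>1 (smult f x + \<phi>1 * y) | x y. True}"
    then obtain x y where "e = T (at_xz f \<phi>1 (smult f x + \<phi>1 * y))" by blast
    then show "e \<in> {at_xz g \<phi>2 (smult g x + \<phi>2 * y) | x y. True}"
      unfolding T_xz s_comb by blast
  next
    fix e assume "e \<in> {at_xz g \<phi>2 (smult g x + \<phi>2 * y) | x y. True}"
    then obtain x' y' where e: "e = at_xz g \<phi>2 (smult g x' + \<phi>2 * y')" by blast
    obtain y where y: "s y = smult [:inverse k:] y'" using subst_xz_surj[OF degs nf(4,5)] s_def by metis
    obtain x where x: "s x = smult [:inverse u:] (x' - \<theta> * s y)"
      using subst_xz_surj[OF degs nf(4,5)] s_def by metis
    have "smult [:k:] (s y) = y'" unfolding y using k by (simp add: one_pCons[symmetric])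
    moreover have "smult [:u:] (s x) = x' - \<theta> * s y" unfolding x using nf(3) by (simp add: one_pCons[symmetric])
    ultimately have "s (smult f x + \<phi>1 * y) = smult g x' + \<phi>2 * y'" unfolding s_comb by simp
    then have "e = T (at_xz f \<phi>1 (smult f x + \<phi>1 * y))" unfolding e T_xz by simp
    then show "e \<in> T ` {at_xz f \<phi>1 (smult f x + \<phi>1 * y) | x y. True}" by blast
  qed
  have vi: "at_xz g \<phi>2 (s \<phi>1) =
        scal g \<phi>2 (\<gamma> ^ d2) \<otimes>\<^bsub>surf g \<phi>2\<^esub> at_xz g \<phi>2 \<phi>2
          \<oplus>\<^bsub>surf g \<phi>2\<^esub> at_x g \<phi>2 g \<otimes>\<^bsub>surf g \<phi>2\<^esub> at_xz g \<phi>2 \<theta>"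
    unfolding s_phi to_cls k_def assms(6) by simp
  have vii: "T (gen_y f \<phi>1) =
        scal g \<phi>2 (inverse u * \<gamma> ^ d2) \<otimes>\<^bsub>surf g \<phi>2\<^esub> gen_y g \<phi>2
          \<oplus>\<^bsub>surf g \<phi>2\<^esub> scal g \<phi>2 (inverse u) \<otimes>\<^bsub>surf g \<phi>2\<^esub> at_xz g \<phi>2 \<theta>"
    unfolding to_cls T_iff nf(10) assms(6) by simp
  have d: "d1 = d2" "degree \<theta> \<le> d2 - 1" using nf(7,9) assms(5,6) by simp_all
  have ii': "\<forall>i\<in>{1..n}. \<exists>j\<in>{1..n}. \<exists>\<mu>ij. \<mu>ij \<noteq> 0
        \<and> T (at_x f \<phi>1 (p i)) = scal g \<phi>2 \<mu>ij \<otimes>\<^bsub>surf g \<phi>2\<^esub> at_x g \<phi>2 (q j)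
        \<and> \<alpha> i = \<beta> j" using ii by blast
  show ?thesis
    by (intro exI conjI) (rule nf(1) nf(2) i_x i_z n_eq_m ii' nf(3) iii d v T_xz[unfolded s_def]
        vi[unfolded s_def] vii)+
qed

end
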